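(* Let $\varphi\in S^2(\mathbb{R})$, $\psi\in S^1(\mathbb{R})$ and $f\in S^0(\mathbb{R}\times[0,\infty))$ be given, and consider the initial value problem $$\begin{cases}\partial^S_tu_t-\partial^S_xu_x=f(x,t),&(x,t)\in\mathbb{R}\times(0,\infty),\\ u(x,0)=\varphi(x),&x\in\mathbb{R},\\ u_t(x,0)=\psi(x),&x\in\mathbb{R}.\end{cases}$$ The $S^2$-solution of this problem (the solution $u\in S^2(\mathbb{R}\times[0,\infty))$) is given by $$u(x,t)=\frac12\left[\varphi(x+t)+\varphi(x-t)\right]+\frac12\int_{x-t}^{x+t}\psi(s)\,ds+\frac12\int_0^t\int_{x-t+s}^{x+t-s}f(y,s)\,dy\,ds.$$
   Context: The statement gives the formula for an $S^2$-solution; existence of an $S^2$-solution for arbitrary data is not asserted by the paper. $u_t,u_x$ are classical partial derivatives; $\partial^S_t,\partial^S_x$ are specular partial derivatives. Let $\Omega\subset\mathbb{R}^n$ be open, $v:\Omega\to\mathbb{R}$, $e_i$ the $i$-th standard basis vector. One-sided limits: $v[a)_{(i)}=\lim_{h\searrow0}v(a+he_i)$, $v(a]_{(i)}=\lim_{h\nearrow0}v(a+he_i)$. Specular partial derivatives: $\partial^R_{x_i}v(a)=\lim_{h\searrow0}\frac{v(a+he_i)-v[a)_{(i)}}{h}$, $\partial^L_{x_i}v(a)=\lim_{h\nearrow0}\frac{v(a+he_i)-v(a]_{(i)}}{h}$ (real numbers). $\partial^S_{x_i}v(a)$ exists if both exist and $v[a)_{(i)}=v(a]_{(i)}$; with $\alpha=\partial^R_{x_i}v(a)$,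 $\beta=\partial^L_{x_i}v(a)$ it equals $A(\alpha,\beta)=\frac{\alpha\beta-1+\sqrt{(\alpha^2+1)(\beta^2+1)}}{\alpha+\beta}$ if $\alpha+\beta\ne0$ and $0$ otherwise. For a multi-index $\alpha$, $(\partial^S)^\alpha v=(\partial^S_{x_1})^{\alpha_1}\cdots(\partial^S_{x_n})^{\alpha_n}v$ with $(\partial^S_{x_i})^0v=v$, $|\alpha|=\sum\alpha_i$; $\partial^S_{x_ix_j}v:=\partial^S_{x_j}\partial^S_{x_i}v$. Singular hyperplanes: an affine hyperplane $\hbar$ in a set $X\subset\mathbb{R}^n$ is given by an equation $c\cdot x=b$, $x\in X$ ($c\in\mathbb{R}^n\setminus\{0\}$, $b\in\mathbb{R}$), with graph $\mathcal{G}(\hbar)=\{x\in X:c\cdot x=b\}$. If $\hbar$ is such a hyperplane in a connected subset of $\Omega$ and there is a variable $x_i$ with $v(x]_{(i)}\ne v[x)_{(i)}$ for all $x\in\mathcal{G}(\hbar)$, then $\hbar$ is a singular hyperplane of $v$. Piecewise continuity: $v$ is piecewise continuous if there are $m\ge0$ singular hyperplanes $\hbar_1,\dots,\hbar_m$ of $v$ in $\Omega$ such that $v$ is continuous in $\Omega\setminus\bigcup_\ell\mathcal{G}(\hbar_\ell)$ and, for each $\ell$, the restriction of $v$ to $\mathcal{G}(\hbar_\ell)$ is continuous on $\mathcal{G}(\hbar_\ell)\setminus\bigcup_{j\ne\ell}\mathcal{G}(\hbar_j)$. $S^0(\Omega)$ (proper functions): all piecewise continuous $v:\Omega\to\mathbb{R}$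 such that for every $a\in\Omega$ and every $i$, $v(a)=A(v(a]_{(i)},v[a)_{(i)})$ if $v(a]_{(i)}+v[a)_{(i)}\ne0$, and $v(a)=0$ if $v(a]_{(i)}+v[a)_{(i)}=0$. $S^k(\Omega)$ for $k\ge1$: all continuous $v:\Omega\to\mathbb{R}$ such that (i) if $|\alpha|\le k$, $(\partial^S)^\alpha v$ exists and is in $S^0(\Omega)$; (ii) if $|\alpha|\le k-2$, $\partial^S_{x_ix_j}(\partial^S)^\alpha v$ is continuous in $\Omega$ whenever $i\ne j$. On $\mathbb{R}\times[0,\infty)$ the spaces $S^0,S^2$ are understood analogously, with one-sided limits and derivatives in $t$ at $t=0$.
   Formalization: Graphs of singular hyperplanes are required to have at most countably many connected components; otherwise a graph can be a Cantor set in a line and the double integral of f may not exist, even in the Henstock–Kurzweil sense used here. *)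

theory Defs
  imports "HOL-Analysis.Analysis"
begin

definition specular_mean :: "real \<Rightarrow> real \<Rightarrow> real" where
  "specular_mean \<alpha> \<beta> =
     (if \<alpha> + \<beta> \<noteq> 0
      then (\<alpha> * \<beta> - 1 + sqrt ((\<alpha>\<^sup>2 + 1) * (\<beta>\<^sup>2 + 1))) / (\<alpha> + \<beta>)
      else 0)"

text \<open>
  Domains are sets \<open>D\<close> in a Euclidean space; only the values of a function on \<open>D\<close> are used.
  The filters below describe the step size \<open>h\<close> in \<open>a + h *\<^sub>R e\<close>. At interior points of \<open>D\<close> they
  are \<open>at_right 0\<close> and \<open>at_left 0\<close>. At a boundary point where \<open>D\<close> can be approached along \<open>e\<close>
  from one side only (such as \<open>t = 0\<close> in the half-plane), both denote the side
  that is available. As \<open>specular_mean c c = c\<close>, every notion built from them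
  then becomes its one-sided version.
\<close>

definition right_side :: "'a::euclidean_space set \<Rightarrow> 'a \<Rightarrow> 'a \<Rightarrow> real filter" where
  "right_side D e a =
     (let R = at 0 within {h. 0 < h \<and> a + h *\<^sub>R e \<in> D};
          L = at 0 within {h. h < 0 \<and> a + h *\<^sub>R e \<in> D}
      in if R = bot then L else R)"

definition left_side :: "'a::euclidean_space set \<Rightarrow> 'a \<Rightarrow> 'a \<Rightarrow> real filter" where
  "left_side D e a =
     (let R = at 0 within {h. 0 < h \<and> a + h *\<^sub>R e \<in> D};
          L = at 0 within {h. h < 0 \<and> a + h *\<^sub>R e \<in> D}
      in if L = bot then R else L)"

lemma right_side_open:
  assumes "open D" "a \<in> D"
  shows "right_side D e a = at_right 0"
proof -
  have "open ((\<lambda>h. a + h *\<^sub>R e) -` D)"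
    by (rule open_vimage[OF assms(1)]) (intro continuous_intros)
  then have "at 0 within {h. 0 < h \<and> a + h *\<^sub>R e \<in> D} = at_right (0::real)"
    using assms(2) by (intro at_within_nhd[where S = "(\<lambda>h. a + h *\<^sub>R e) -` D"]) auto
  then show ?thesis by (simp add: right_side_def Let_def)
qed

lemma left_side_open:
  assumes "open D" "a \<in> D"
  shows "left_side D e a = at_left 0"
proof -
  have "open ((\<lambda>h. a + h *\<^sub>R e) -` D)"
    by (rule open_vimage[OF assms(1)]) (intro continuous_intros)
  then have "at 0 within {h. h < 0 \<and> a + h *\<^sub>R e \<in> D} = at_left (0::real)"
    using assms(2) by (intro at_within_nhd[where S = "(\<lambda>h. a + h *\<^sub>R e) -` D"]) auto
  then show ?thesis by (simp add: left_side_def Let_def)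
qed

definition has_right_limit ::
    "'a::euclidean_space set \<Rightarrow> ('a \<Rightarrow> real) \<Rightarrow> 'a \<Rightarrow> 'a \<Rightarrow> real \<Rightarrow> bool" where
  "has_right_limit D v e a r \<longleftrightarrow> ((\<lambda>h. v (a + h *\<^sub>R e)) \<longlongrightarrow> r) (right_side D e a)"

definition has_left_limit ::
    "'a::euclidean_space set \<Rightarrow> ('a \<Rightarrow> real) \<Rightarrow> 'a \<Rightarrow> 'a \<Rightarrow> real \<Rightarrow> bool" where
  "has_left_limit D v e a l \<longleftrightarrow> ((\<lambda>h. v (a + h *\<^sub>R e)) \<longlongrightarrow> l) (left_side D e a)"

text \<open>
  The difference quotients are taken with respect to the common one-sided limit \<open>c\<close>, not to \<open>v a\<close>.
\<close>

definition has_specular_derivative ::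
    "'a::euclidean_space set \<Rightarrow> ('a \<Rightarrow> real) \<Rightarrow> 'a \<Rightarrow> 'a \<Rightarrow> real \<Rightarrow> bool" where
  "has_specular_derivative D v e a d \<longleftrightarrow>
     (\<exists>c \<alpha> \<beta>. has_right_limit D v e a c \<and> has_left_limit D v e a c \<and>
        ((\<lambda>h. (v (a + h *\<^sub>R e) - c) / h) \<longlongrightarrow> \<alpha>) (right_side D e a) \<and>
        ((\<lambda>h. (v (a + h *\<^sub>R e) - c) / h) \<longlongrightarrow> \<beta>) (left_side D e a) \<and>
        d = specular_mean \<alpha> \<beta>)"

definition specular_deriv ::
    "'a::euclidean_space set \<Rightarrow> 'a \<Rightarrow> ('a \<Rightarrow> real) \<Rightarrow> 'a \<Rightarrow> real" where
  "specular_deriv D e v = (\<lambda>a. THE d. has_specular_derivative D v e a d)"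

definition has_partial_derivative ::
    "'a::euclidean_space set \<Rightarrow> ('a \<Rightarrow> real) \<Rightarrow> 'a \<Rightarrow> 'a \<Rightarrow> real \<Rightarrow> bool" where
  "has_partial_derivative D v e a d \<longleftrightarrow>
     ((\<lambda>h. v (a + h *\<^sub>R e)) has_real_derivative d) (at 0 within {h. a + h *\<^sub>R e \<in> D})"

text \<open>
  Iterated specular derivatives along a list of directions; the head of the list is the
  outermost (last applied) operator.
\<close>

primrec specular_derivs ::
    "'a::euclidean_space set \<Rightarrow> 'a list \<Rightarrow> ('a \<Rightarrow> real) \<Rightarrow> 'a \<Rightarrow> real" where
  "specular_derivs D [] v = v"
| "specular_derivs D (e # es) v = specular_deriv D e (specular_derivs D es v)"

primrec specular_derivs_exist ::
    "'a::euclidean_space set \<Rightarrow> 'a list \<Rightarrow> ('a \<Rightarrow> real) \<Rightarrow> bool" where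
  "specular_derivs_exist D [] v \<longleftrightarrow> True"
| "specular_derivs_exist D (e # es) v \<longleftrightarrow>
     specular_derivs_exist D es v \<and>
     (\<forall>a\<in>D. \<exists>d. has_specular_derivative D (specular_derivs D es v) e a d)"

text \<open>
  \<open>G\<close> is the graph of a singular hyperplane of \<open>v\<close>. A connected set \<open>X\<close> can meet a
  hyperplane in an arbitrary set, for instance in a Cantor set (an open half-space together with
  an arbitrary part of its boundary is connected); the countability condition excludes this. It
  holds whenever \<open>X\<close> is convex (see below) or relatively open in a convex \<open>D\<close>.
\<close>

definition singular_hyperplane_graph ::
    "'a::euclidean_space set \<Rightarrow> ('a \<Rightarrow> real) \<Rightarrow> 'a set \<Rightarrow> bool" where
  "singular_hyperplane_graph D v G \<longleftrightarrow>
     (\<exists>X c b. connected X \<and> X \<subseteq> D \<and> c \<noteq> 0 \<and> G = {x \<in> X. c \<bullet> x = b}) \<and>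
     countable (components G) \<and>
     (\<exists>e\<in>Basis. \<forall>x\<in>G. \<exists>l r. has_left_limit D v e x l \<and> has_right_limit D v e x r \<and> l \<noteq> r)"

lemma countable_components_convex_hyperplane:
  fixes X :: "'a::euclidean_space set"
  assumes "convex X"
  shows "countable (components {x \<in> X. c \<bullet> x = b})"
proof -
  have "{x \<in> X. c \<bullet> x = b} = X \<inter> {x. c \<bullet> x = b}" by auto
  then have "connected {x \<in> X. c \<bullet> x = b}"
    using assms by (simp add: convex_Int convex_hyperplane convex_connected)
  then show ?thesis
    by (metis components_eq_sing_iff components_empty countable_empty countable_insert)
qed

definition piecewise_continuous_on :: "'a::euclidean_space set \<Rightarrow> ('a \<Rightarrow> real) \<Rightarrow> bool" where
  "piecewise_continuous_on D v \<longleftrightarrow>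
     (\<exists>\<G>. finite \<G> \<and> (\<forall>G\<in>\<G>. singular_hyperplane_graph D v G) \<and>
        continuous_on (D - \<Union>\<G>) v \<and>
        (\<forall>G\<in>\<G>. continuous_on (G - \<Union>(\<G> - {G})) v))"

definition proper_functions :: "'a::euclidean_space set \<Rightarrow> ('a \<Rightarrow> real) set" where
  "proper_functions D =
     {v. piecewise_continuous_on D v \<and>
         (\<forall>a\<in>D. \<forall>e\<in>Basis. \<exists>l r. has_left_limit D v e a l \<and> has_right_limit D v e a r \<and>
            v a = specular_mean l r)}"

text \<open>
  The order in which a multi-index derivative is carried out depends on the order of the
  coordinates, so the coordinate directions are given as a list \<open>bs = [e\<^sub>1, \<dots>, e\<^sub>n]\<close> enumerating
  the standard basis, and \<open>\<alpha> e\<^sub>i\<close> is the \<open>i\<close>-th entry of the multi-index.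
\<close>

definition multi_index_dirs :: "'a list \<Rightarrow> ('a \<Rightarrow> nat) \<Rightarrow> 'a list" where
  "multi_index_dirs bs \<alpha> = concat (map (\<lambda>e. replicate (\<alpha> e) e) bs)"

definition S_space :: "'a::euclidean_space list \<Rightarrow> nat \<Rightarrow> 'a set \<Rightarrow> ('a \<Rightarrow> real) set" where
  "S_space bs k D =
     (if k = 0 then proper_functions D
      else {v. continuous_on D v \<and>
        (\<forall>\<alpha>. sum_list (map \<alpha> bs) \<le> k \<longrightarrow>
           specular_derivs_exist D (multi_index_dirs bs \<alpha>) v \<and>
           specular_derivs D (multi_index_dirs bs \<alpha>) v \<in> proper_functions D) \<and>
        (\<forall>\<alpha>. sum_list (map \<alpha> bs) + 2 \<le> k \<longrightarrow>
           (\<forall>e\<in>set bs. \<forall>e'\<in>set bs. e \<noteq> e' \<longrightarrow>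
              specular_derivs_exist D (e' # e # multi_index_dirs bs \<alpha>) v \<and>
              continuous_on D (specular_derivs D (e' # e # multi_index_dirs bs \<alpha>) v)))})"

text \<open>
  Points of the half-plane are pairs \<open>(x, t)\<close>.
\<close>

abbreviation half_plane :: "(real \<times> real) set" where
  "half_plane \<equiv> UNIV \<times> {0..}"

abbreviation e_x :: "real \<times> real" where "e_x \<equiv> (1, 0)"
abbreviation e_t :: "real \<times> real" where "e_t \<equiv> (0, 1)"

abbreviation S_line :: "nat \<Rightarrow> (real \<Rightarrow> real) set" where
  "S_line k \<equiv> S_space [1] k UNIV"

abbreviation S_half_plane :: "nat \<Rightarrow> (real \<times> real \<Rightarrow> real) set" where
  "S_half_plane k \<equiv> S_space [e_x, e_t] k half_plane"

lemma set_basis_line: "distinct [1::real]" "set [1::real] = Basis"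
  by simp_all

lemma set_basis_half_plane: "distinct [e_x, e_t]" "set [e_x, e_t] = Basis"
  by (auto simp: Basis_prod_def)

lemma specular_mean_same: "specular_mean c c = c"
proof (cases "c = 0")
  case False
  have "sqrt ((c\<^sup>2 + 1) * (c\<^sup>2 + 1)) = c\<^sup>2 + 1" by simp
  then show ?thesis using False by (simp add: specular_mean_def power2_eq_square)
qed (simp add: specular_mean_def)

end

theory Submission
  imports Defs
begin

text \<open>
  Being proper and specularly differentiable in both directions, \<open>u\<^sub>t\<close> and \<open>u\<^sub>x\<close> have no singular
  hyperplanes and are continuous. On a line a specular derivative is a classical one off a
  countable set, so the fundamental theorem of calculus holds with countably many exceptions.
  The singular graphs of the second derivative in \<open>t\<close> meet only countably many levels \<open>t = s\<close>:
  a jump along a non-horizontal segment is excluded because \<open>u\<^sub>t\<close> and its space derivative are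
  continuous. At every other level the integral of \<open>u\<^sub>t\<close> over a slice of the characteristic
  triangle can be differentiated under the integral sign. Hence
  \<open>Z s = \<integral> u\<^sub>t(y, s) dy + u(x + t - s, s) + u(x - t + s, s)\<close>, with the integral over
  \<open>[x - t + s, x + t - s]\<close>, has the derivative \<open>\<integral> f(y, s) dy\<close> off a countable set, and the formula
  is \<open>Z t - Z 0 = \<integral> Z'\<close>. No Fubini theorem is used, as the second derivatives need not be
  locally bounded.
\<close>

subsection \<open>Specular derivatives on the half-plane\<close>

text \<open>The obstacle is how little S^2 says about second derivatives near a singular graph.
  One-sided limits exist along the axes only, with no uniformity. A graph is a piece of a line with
  at most countably many components: it need not be closed and may accumulate at a level that it
  misses. Isolated jump points can occur: the function \<open>sqrt (t^2 + y^4)\<close>, moved to an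
  interior point, has a continuous \<open>y\<close>-derivative there, while its
  \<open>t\<close>-derivative jumps at that point alone. So the graphs cannot be reduced to
  horizontal pieces; only the set of their levels is controlled. At any other level the second time
  derivative is continuous merely relative to the complement of the graphs, and estimates on
  vertical lines must tolerate countable exceptional sets. The gauge integral makes this possible: a
  continuous function is the integral of its derivative even if the derivative is unbounded and is
  missing at countably many points.\<close>

lemma right_side_interior:
  assumes "a \<in> interior D"
  shows "right_side D e a = at_right 0"
proof -
  have "open ((\<lambda>h. a + h *\<^sub>R e) -` interior D)"
    by (rule open_vimage[OF open_interior]) (intro continuous_intros)
  then have "at 0 within {h. 0 < h \<and> a + h *\<^sub>R e \<in> D} = at_right (0::real)"
    using assms interior_subset[of D]
    by (intro at_within_nhd[where S = "(\<lambda>h. a + h *\<^sub>R e) -` interior D"]) auto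
  then show ?thesis by (simp add: right_side_def Let_def)
qed

lemma left_side_interior:
  assumes "a \<in> interior D"
  shows "left_side D e a = at_left 0"
proof -
  have "open ((\<lambda>h. a + h *\<^sub>R e) -` interior D)"
    by (rule open_vimage[OF open_interior]) (intro continuous_intros)
  then have "at 0 within {h. h < 0 \<and> a + h *\<^sub>R e \<in> D} = at_left (0::real)"
    using assms interior_subset[of D]
    by (intro at_within_nhd[where S = "(\<lambda>h. a + h *\<^sub>R e) -` interior D"]) auto
  then show ?thesis by (simp add: left_side_def Let_def)
qed

lemma right_side_le: "right_side D e a \<le> at 0 within {h. a + h *\<^sub>R e \<in> D}"
  by (auto simp: right_side_def Let_def intro!: at_le)

lemma left_side_le: "left_side D e a \<le> at 0 within {h. a + h *\<^sub>R e \<in> D}"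
  by (auto simp: left_side_def Let_def intro!: at_le)

lemma eventually_right_side: "\<forall>\<^sub>F h in right_side D e a. a + h *\<^sub>R e \<in> D"
  by (rule filter_leD[OF right_side_le]) (auto simp: eventually_at_filter)

lemma eventually_left_side: "\<forall>\<^sub>F h in left_side D e a. a + h *\<^sub>R e \<in> D"
  by (rule filter_leD[OF left_side_le]) (auto simp: eventually_at_filter)

lemma interior_half_plane: "interior half_plane = UNIV \<times> {0<..}"
  by (simp add: interior_Times)

text \<open>Level 0 is the only place where a filter degenerates: no negative step in direction
  \<open>e_t\<close> stays in the half-plane, so \<open>left_side\<close> falls back on positive
  steps.\<close>

lemma half_plane_sides:
  assumes "a \<in> half_plane"
  shows "right_side half_plane e_x a = at_right 0" "left_side half_plane e_x a = at_left 0"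
    "right_side half_plane e_t a = at_right 0"
    "left_side half_plane e_t a = (if snd a > 0 then at_left 0 else at_right 0)"
proof -
  obtain y s where a: "a = (y, s)" "0 \<le> s" using assms by (cases a) auto
  have eq: "{h. 0 < h \<and> a + h *\<^sub>R e_x \<in> half_plane} = {0<..}"
      "{h. h < 0 \<and> a + h *\<^sub>R e_x \<in> half_plane} = {..<0}"
      "{h. 0 < h \<and> a + h *\<^sub>R e_t \<in> half_plane} = {0<..}"
    using a by auto
  show "right_side half_plane e_x a = at_right 0" "left_side half_plane e_x a = at_left 0"
    "right_side half_plane e_t a = at_right 0"
    unfolding right_side_def left_side_def Let_def eq by simp_all
  show "left_side half_plane e_t a = (if snd a > 0 then at_left 0 else at_right 0)"
  proof (cases "s > 0")
    case True
    then show ?thesis using a by (simp add: left_side_interior interior_half_plane)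
  next
    case False
    then have L: "{h. h < 0 \<and> a + h *\<^sub>R e_t \<in> half_plane} = {}" using a by auto
    have "left_side half_plane e_t a = at_right 0" unfolding left_side_def Let_def eq L by simp
    then show ?thesis using a False by simp
  qed
qed

lemma half_plane_sides_nontrivial:
  assumes "a \<in> half_plane" "e \<in> Basis"
  shows "right_side half_plane e a \<noteq> bot" "left_side half_plane e a \<noteq> bot"
proof -
  from assms(2) consider "e = e_x" | "e = e_t" unfolding set_basis_half_plane(2)[symmetric] by auto
  then show "right_side half_plane e a \<noteq> bot" "left_side half_plane e a \<noteq> bot"
    by (cases; simp add: half_plane_sides[OF assms(1)])+
qed

lemma has_specular_derivative_unique:
  assumes "right_side D e a \<noteq> bot" "left_side D e a \<noteq> bot"
    and "has_specular_derivative D v e a d" "has_specular_derivative D v e a d'"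
  shows "d = d'"
proof -
  from assms(3) obtain c \<alpha> \<beta> where 1: "((\<lambda>h. v (a + h *\<^sub>R e)) \<longlongrightarrow> c) (right_side D e a)"
    "((\<lambda>h. (v (a + h *\<^sub>R e) - c) / h) \<longlongrightarrow> \<alpha>) (right_side D e a)"
    "((\<lambda>h. (v (a + h *\<^sub>R e) - c) / h) \<longlongrightarrow> \<beta>) (left_side D e a)" "d = specular_mean \<alpha> \<beta>"
    unfolding has_specular_derivative_def has_right_limit_def by blast
  from assms(4) obtain c' \<alpha>' \<beta>' where 2: "((\<lambda>h. v (a + h *\<^sub>R e)) \<longlongrightarrow> c') (right_side D e a)"
    "((\<lambda>h. (v (a + h *\<^sub>R e) - c') / h) \<longlongrightarrow> \<alpha>') (right_side D e a)"
    "((\<lambda>h. (v (a + h *\<^sub>R e) - c') / h) \<longlongrightarrow> \<beta>') (left_side D e a)" "d' = specular_mean \<alpha>' \<beta>'"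
    unfolding has_specular_derivative_def has_right_limit_def by blast
  have c: "c' = c" using tendsto_unique[OF assms(1) 2(1) 1(1)] .
  have "\<alpha>' = \<alpha>" "\<beta>' = \<beta>"
    using tendsto_unique[OF assms(1) 2(2)[unfolded c] 1(2)]
      tendsto_unique[OF assms(2) 2(3)[unfolded c] 1(3)] .
  then show ?thesis using 1(4) 2(4) by simp
qed

lemma specular_deriv_eq:
  assumes "right_side D e a \<noteq> bot" "left_side D e a \<noteq> bot"
    and "has_specular_derivative D v e a d"
  shows "specular_deriv D e v a = d"
  unfolding specular_deriv_def
  using assms has_specular_derivative_unique by blast

lemma has_specular_derivative_cong:
  assumes "\<And>z. z \<in> D \<Longrightarrow> v z = v' z" "has_specular_derivative D v e a d"
  shows "has_specular_derivative D v' e a d"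
proof -
  have eq: "\<forall>\<^sub>F h in right_side D e a. v (a + h *\<^sub>R e) = v' (a + h *\<^sub>R e)"
    "\<forall>\<^sub>F h in left_side D e a. v (a + h *\<^sub>R e) = v' (a + h *\<^sub>R e)"
    using eventually_right_side[of a e D] eventually_left_side[of a e D]
    by (auto elim!: eventually_mono simp: assms(1))
  have "\<forall>\<^sub>F h in right_side D e a. (v (a + h *\<^sub>R e) - c) / h = (v' (a + h *\<^sub>R e) - c) / h"
    "\<forall>\<^sub>F h in left_side D e a. (v (a + h *\<^sub>R e) - c) / h = (v' (a + h *\<^sub>R e) - c) / h" for c
    using eq by (auto elim!: eventually_mono)
  note eq' = this[THEN tendsto_cong] eq[THEN tendsto_cong]
  show ?thesis
    using assms(2)
    unfolding has_specular_derivative_def has_right_limit_def has_left_limit_def eq' .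
qed

text \<open>Both filters are finer than the two-sided one, so both slopes are \<open>d\<close>, and
  the mean of equal slopes is that slope. This identifies the classical \<open>u_t\<close> and
  \<open>u_x\<close> with the operators that define the space.\<close>

lemma has_partial_derivative_imp_specular:
  assumes "has_partial_derivative D v e a d"
  shows "has_specular_derivative D v e a d"
proof -
  let ?F = "at 0 within {h. a + h *\<^sub>R e \<in> D}"
  have "((\<lambda>h. v (a + h *\<^sub>R e)) has_real_derivative d) ?F"
    using assms unfolding has_partial_derivative_def .
  then have "((\<lambda>h. (v (a + h *\<^sub>R e) - v a) / h) \<longlongrightarrow> d) ?F"
    and "((\<lambda>h. v (a + h *\<^sub>R e)) \<longlongrightarrow> v a) ?F"
    using DERIV_continuous[of "\<lambda>h. v (a + h *\<^sub>R e)" d 0]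
    by (auto simp: has_field_derivative_iff continuous_within)
  note lim = this[THEN tendsto_mono[OF right_side_le]] this[THEN tendsto_mono[OF left_side_le]]
  show ?thesis
    unfolding has_specular_derivative_def has_right_limit_def has_left_limit_def
    by (intro exI[of _ "v a"] exI[of _ d] conjI lim specular_mean_same[symmetric])
qed

text \<open>A specular derivative presupposes that the one-sided limits in its direction agree,
  which contradicts the jump at a point of a nonempty graph. All graphs are then empty, and the
  piecewise clause becomes plain continuity.\<close>

lemma proper_specular_differentiable_imp_continuous:
  assumes "v \<in> proper_functions D"
    and nontrivial: "\<And>a e. a \<in> D \<Longrightarrow> e \<in> Basis \<Longrightarrow> right_side D e a \<noteq> bot \<and> left_side D e a \<noteq> bot"
    and diff: "\<And>a e. a \<in> D \<Longrightarrow> e \<in> Basis \<Longrightarrow> \<exists>d. has_specular_derivative D v e a d"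
  shows "continuous_on D v"
proof -
  have empty: "G = {}" if G: "singular_hyperplane_graph D v G" for G
  proof (rule ccontr)
    assume "G \<noteq> {}"
    then obtain a where "a \<in> G" by auto
    have "G \<subseteq> D" using G unfolding singular_hyperplane_graph_def by (elim conjE exE) blast
    then have "a \<in> D" using \<open>a \<in> G\<close> by blast
    from G \<open>a \<in> G\<close> obtain e l r where "e \<in> Basis"
      and lr: "has_left_limit D v e a l" "has_right_limit D v e a r" "l \<noteq> r"
      unfolding singular_hyperplane_graph_def by (elim conjE bexE) blast
    obtain c where c: "has_right_limit D v e a c" "has_left_limit D v e a c"
      using diff[OF \<open>a \<in> D\<close> \<open>e \<in> Basis\<close>] unfolding has_specular_derivative_def by blast
    have "l = c" "r = c"
      using nontrivial[OF \<open>a \<in> D\<close> \<open>e \<in> Basis\<close>] lr(1,2) c tendsto_unique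
      unfolding has_left_limit_def has_right_limit_def by blast+
    then show False using lr(3) by simp
  qed
  from assms(1) obtain \<G> where "\<forall>G\<in>\<G>. singular_hyperplane_graph D v G"
    and "continuous_on (D - \<Union>\<G>) v"
    unfolding proper_functions_def piecewise_continuous_on_def by auto
  moreover have "\<Union>\<G> = {}" using calculation(1) empty by blast
  ultimately show ?thesis by simp
qed

subsection \<open>Countable exceptional sets\<close>

text \<open>
  The exceptional set is absorbed by a bounded monotone function \<open>J\<close> jumping at the \<open>n\<close>-th
  exceptional point by \<open>2\<^sup>-\<^sup>n\<close> on either side.
\<close>

lemma fundamental_theorem_of_calculus_countable:
  fixes f :: "real \<Rightarrow> 'a::banach"
  assumes "countable S" "a \<le> b" "continuous_on {a..b} f"
    and deriv: "\<And>x. x \<in> {a<..<b} - S \<Longrightarrow> (f has_vector_derivative f' x) (at x)"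
  shows "(f' has_integral (f b - f a)) {a..b}"
proof -
  \<comment> \<open>The endpoints count as exceptional, the derivative being given in the open
    interval only.\<close>
  define T where "T = insert a (insert b S)"
  have T: "countable T" using assms(1) by (auto simp: T_def)
  define s where "s = from_nat_into T"
  define \<nu> where "\<nu> = to_nat_on T"
  have \<nu>: "s (\<nu> x) = x" if "x \<in> T" for x
    unfolding \<nu>_def s_def using from_nat_into_to_nat_on[OF T that] .
  \<comment> \<open>Two terms, because a tag may be an endpoint of its cell:
    \<open>s n \<le> y\<close> registers a cell that ends at \<open>s n\<close>, and
    \<open>s n < y\<close> one that begins there.\<close>
  define j :: "real \<Rightarrow> nat \<Rightarrow> real"
    where "j y n = (1/2) ^ n * (of_bool (s n \<le> y) + of_bool (s n < y))" for y n
  have j: "0 \<le> j y n" "j y n \<le> 2 * (1/2) ^ n" for y n by (auto simp: j_def)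
  have j_mono: "j u n \<le> j v n" if "u \<le> v" for u v n using that by (auto simp: j_def)
  have geo: "summable (\<lambda>n. 2 * (1/2) ^ n :: real)" by (intro summable_mult summable_geometric) simp
  have summ: "summable (j y)" for y
  proof (rule summable_comparison_test'[OF geo, of 0])
    show "norm (j y n) \<le> 2 * (1/2) ^ n" for n using j[of y n] by simp
  qed
  define J where "J y = suminf (j y)" for y
  have J0: "0 \<le> J y" for y unfolding J_def by (intro suminf_nonneg summ j)
  have J4: "J y \<le> 4" for y
  proof -
    have "J y \<le> (\<Sum>n. 2 * (1/2) ^ n)" unfolding J_def by (intro suminf_le summ geo j)
    also have "\<dots> = 4" by (subst suminf_mult) (auto simp: suminf_geometric)
    finally show ?thesis .
  qed
  have J_diff: "J v - J u = (\<Sum>n. j v n - j u n)" for u v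
    unfolding J_def by (intro suminf_diff summ)
  have J_mono: "0 \<le> J v - J u" if "u \<le> v" for u v
    unfolding J_diff by (intro suminf_nonneg summable_diff summ) (use j_mono[OF that] in simp)
  have J_jump: "(1/2) ^ \<nu> x \<le> J v - J u" if "x \<in> T" "u \<le> x" "x \<le> v" "u < v" for x u v
  proof -
    have "(1/2) ^ \<nu> x \<le> j v (\<nu> x) - j u (\<nu> x)"
      using that \<nu>[OF that(1)] by (auto simp: j_def)
    also have "\<dots> = (\<Sum>n\<in>{\<nu> x}. j v n - j u n)" by simp
    also have "\<dots> \<le> (\<Sum>n. j v n - j u n)"
      by (rule sum_le_suminf) (use j_mono[of u v] that summable_diff[OF summ summ] in auto)
    finally show ?thesis unfolding J_diff .
  qed
  have "(f' has_integral (f b - f a)) (cbox a b)"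
    unfolding has_integral
  proof safe
    fix e :: real assume "e > 0"
    \<comment> \<open>The total error will be
      \<open>\<epsilon> * ((b - a) + 2 * (J b - J a))\<close>, at most
      \<open>\<epsilon> * (b - a + 8)\<close> because \<open>J\<close> lies between 0 and 4; the 10
      leaves room for strictness.\<close>
    define \<epsilon> where "\<epsilon> = e / (b - a + 10)"
    have \<epsilon>: "\<epsilon> > 0" using \<open>e > 0\<close> assms(2) by (simp add: \<epsilon>_def)
    \<comment> \<open>Off \<open>T\<close> the derivative makes the error proportional to
      \<open>\<bar>y - x\<bar>\<close>. On \<open>T\<close> continuity alone brings it below the
      weight reserved for \<open>x\<close>.\<close>
    have "\<exists>d>0. x \<in> {a..b} \<longrightarrow> (\<forall>y\<in>{a..b}. \<bar>y - x\<bar> < d \<longrightarrow>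
        norm (f y - f x - (y - x) *\<^sub>R f' x) \<le>
          (if x \<in> T then \<epsilon> * (1/2) ^ \<nu> x else \<epsilon> * \<bar>y - x\<bar>))" for x
    proof (cases "x \<in> {a..b}")
      case True
      show ?thesis
      proof (cases "x \<in> T")
        case False
        then have "(f has_vector_derivative f' x) (at x)"
          using True deriv[of x] by (force simp: T_def)
        then have "(f has_derivative (\<lambda>h. h *\<^sub>R f' x)) (at x)"
          by (simp add: has_vector_derivative_def)
        then obtain d where "d > 0" "\<And>y. norm (y - x) < d \<Longrightarrow>
            norm (f y - f x - (y - x) *\<^sub>R f' x) \<le> \<epsilon> * norm (y - x)"
          using \<epsilon> unfolding has_derivative_at_alt by blast
        then show ?thesis using False by (intro exI[of _ d]) auto
      next
        case xT: True
        have "continuous_on {a..b} (\<lambda>y. f y - f x - (y - x) *\<^sub>R f' x)"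
          by (intro continuous_intros assms(3))
        then have "\<forall>e>0. \<exists>d>0. \<forall>y\<in>{a..b}. dist y x < d \<longrightarrow>
            dist (f y - f x - (y - x) *\<^sub>R f' x) (f x - f x - (x - x) *\<^sub>R f' x) < e"
          using True unfolding continuous_on_iff by blast
        moreover have "\<epsilon> * (1/2) ^ \<nu> x > 0" using \<epsilon> by simp
        ultimately obtain d where "d > 0" "\<forall>y\<in>{a..b}. dist y x < d \<longrightarrow>
            dist (f y - f x - (y - x) *\<^sub>R f' x) (f x - f x - (x - x) *\<^sub>R f' x) < \<epsilon> * (1/2) ^ \<nu> x"
          by blast
        then show ?thesis using xT by (intro exI[of _ d]) (auto simp: dist_real_def dist_norm)
      qed
    qed (auto intro: exI[of _ 1])
    then obtain d where d: "\<And>x. 0 < d x" "\<And>x y. x \<in> {a..b} \<Longrightarrow> y \<in> {a..b} \<Longrightarrow> \<bar>y - x\<bar> < d x \<Longrightarrow>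
        norm (f y - f x - (y - x) *\<^sub>R f' x) \<le>
          (if x \<in> T then \<epsilon> * (1/2) ^ \<nu> x else \<epsilon> * \<bar>y - x\<bar>)"
      by metis
    show "\<exists>\<gamma>. gauge \<gamma> \<and> (\<forall>\<D>. \<D> tagged_division_of cbox a b \<and> \<gamma> fine \<D> \<longrightarrow>
        norm ((\<Sum>(x, k)\<in>\<D>. measure lborel k *\<^sub>R f' x) - (f b - f a)) < e)"
    proof (rule exI, safe)
      show "gauge (\<lambda>x. ball x (d x))" using d(1) gauge_ball_dependent by blast
    next
      fix p
      assume ptag: "p tagged_division_of cbox a b" and finep: "(\<lambda>x. ball x (d x)) fine p"
      have sums: "b - a = (\<Sum>(x,K)\<in>p. Sup K - Inf K)" "f b - f a = (\<Sum>(x,K)\<in>p. f (Sup K) - f (Inf K))"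
          "J b - J a = (\<Sum>(x,K)\<in>p. J (Sup K) - J (Inf K))"
        using additive_tagged_division_1[where f= "\<lambda>x. x"] additive_tagged_division_1[where f= f]
          additive_tagged_division_1[where f= J] \<open>a \<le> b\<close> ptag by auto
      have "norm (\<Sum>(x, K)\<in>p. (measure lborel K *\<^sub>R f' x) - (f (Sup K) - f (Inf K)))
          \<le> (\<Sum>n\<in>p. \<epsilon> * (case n of (x, K) \<Rightarrow> (Sup K - Inf K) + 2 * (J (Sup K) - J (Inf K))))"
      proof (rule sum_norm_le, safe)
        fix x K
        assume xK: "(x, K) \<in> p"
        then have "x \<in> K" and kab: "K \<subseteq> cbox a b" using ptag by blast+
        then obtain u v where k: "K = cbox u v" using ptag xK by auto
        have uv: "u \<le> x" "x \<le> v" using \<open>x \<in> K\<close> unfolding k by auto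
        have uvK: "u \<in> K" "v \<in> K" using uv by (simp_all add: k)
        have ball: "\<bar>u - x\<bar> < d x" "\<bar>v - x\<bar> < d x"
          using finep xK uvK by (force simp: dist_real_def fine_def)+
        have ab: "x \<in> {a..b}" "u \<in> {a..b}" "v \<in> {a..b}" using \<open>x \<in> K\<close> uvK kab by auto
        let ?R = "\<lambda>y. if x \<in> T then \<epsilon> * (1/2) ^ \<nu> x else \<epsilon> * \<bar>y - x\<bar>"
        \<comment> \<open>The two ends of a cell with an exceptional tag cost one weight each, and
          \<open>J v - J u\<close> is at least that weight; hence the factor 2.\<close>
        have main: "norm ((v - u) *\<^sub>R f' x - (f v - f u)) \<le> \<epsilon> * ((v - u) + 2 * (J v - J u))"
        proof (cases "u < v")
          case True
          have "norm ((v - u) *\<^sub>R f' x - (f v - f u)) =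
              norm (f u - f x - (u - x) *\<^sub>R f' x - (f v - f x - (v - x) *\<^sub>R f' x))"
            by (auto simp: algebra_simps)
          also have "\<dots> \<le> norm (f u - f x - (u - x) *\<^sub>R f' x) + norm (f v - f x - (v - x) *\<^sub>R f' x)"
            by (rule norm_triangle_ineq4)
          also have "\<dots> \<le> ?R u + ?R v"
            by (intro add_mono d ab ball)
          also have "\<dots> \<le> \<epsilon> * ((v - u) + 2 * (J v - J u))"
          proof (cases "x \<in> T")
            case xT: True
            have "?R u + ?R v = \<epsilon> * (2 * (1/2) ^ \<nu> x)" using xT by simp
            also have "\<dots> \<le> \<epsilon> * ((v - u) + 2 * (J v - J u))"
              using J_jump[OF xT uv True] True \<epsilon> by (intro mult_left_mono) auto
            finally show ?thesis .
          next
            case False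
            have "?R u + ?R v = \<epsilon> * (v - u)" using False uv by (simp add: algebra_simps)
            also have "\<dots> \<le> \<epsilon> * ((v - u) + 2 * (J v - J u))"
              using J_mono[of u v] uv \<epsilon> by (intro mult_left_mono) auto
            finally show ?thesis .
          qed
          finally show ?thesis .
        next
          case False
          then have "u = v" using uv by simp
          then show ?thesis by simp
        qed
        show "norm (measure lborel K *\<^sub>R f' x - (f (Sup K) - f (Inf K)))
            \<le> \<epsilon> * ((Sup K - Inf K) + 2 * (J (Sup K) - J (Inf K)))"
          using main uv by (simp add: k)
      qed
      also have "\<dots> = \<epsilon> * ((b - a) + 2 * (J b - J a))"
        unfolding sums by (simp only: split_def sum.distrib flip: sum_distrib_left)
      also have "\<dots> \<le> \<epsilon> * (b - a + 8)"
        using \<epsilon> J0[of a] J4[of b] by (intro mult_left_mono) auto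
      also have "\<dots> < \<epsilon> * (b - a + 10)" using \<epsilon> by simp
      also have "\<dots> = e" using assms(2) by (simp add: \<epsilon>_def)
      finally show "norm ((\<Sum>(x, k)\<in>p. measure lborel k *\<^sub>R f' x) - (f b - f a)) < e"
        unfolding sums(2) by (simp add: split_def sum_subtractf)
    qed
  qed
  then show ?thesis by simp
qed

text \<open>The rational triple is a label. Two points with the same label lie in a common window,
  which \<open>sep\<close> forbids, so the labelling is injective.\<close>

lemma countable_rational_separation:
  fixes R :: "real \<Rightarrow> real \<Rightarrow> real \<Rightarrow> real \<Rightarrow> bool"
  assumes ex: "\<And>x. x \<in> S \<Longrightarrow> \<exists>a\<in>\<rat>. \<exists>b\<in>\<rat>. \<exists>r\<in>\<rat>. a < x \<and> x < b \<and> R a b r x"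
    and sep: "\<And>a b r x y. x \<in> S \<Longrightarrow> y \<in> S \<Longrightarrow> R a b r x \<Longrightarrow> R a b r y \<Longrightarrow>
      a < x \<Longrightarrow> x < y \<Longrightarrow> y < b \<Longrightarrow> False"
  shows "countable S"
proof -
  obtain A B C where ABC: "\<And>x. x \<in> S \<Longrightarrow> A x \<in> \<rat> \<and> B x \<in> \<rat> \<and> C x \<in> \<rat> \<and> A x < x \<and> x < B x \<and>
      R (A x) (B x) (C x) x"
    using ex by metis
  have "inj_on (\<lambda>x. (A x, B x, C x)) S"
  proof (rule inj_onI)
    fix x y assume xy: "x \<in> S" "y \<in> S" "(A x, B x, C x) = (A y, B y, C y)"
    then have eq: "A y = A x" "B y = B x" "C y = C x" by auto
    note x = ABC[OF xy(1)] and y = ABC[OF xy(2), unfolded eq]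
    have "\<not> x < y" using sep[OF xy(1,2), of "A x" "B x" "C x"] x y by blast
    moreover have "\<not> y < x" using sep[OF xy(2,1), of "A x" "B x" "C x"] x y by blast
    ultimately show "x = y" by simp
  qed
  moreover have "(\<lambda>x. (A x, B x, C x)) ` S \<subseteq> \<rat> \<times> \<rat> \<times> \<rat>"
    using ABC by (intro image_subsetI SigmaI) simp_all
  then have "countable ((\<lambda>x. (A x, B x, C x)) ` S)"
    by (rule countable_subset) (intro countable_SIGMA countable_rat)
  ultimately show ?thesis using countable_image_inj_on by blast
qed

lemma rational_window:
  fixes x :: real
  assumes "\<forall>\<^sub>F y in at_left x. Q y" "\<forall>\<^sub>F y in at_right x. Q' y"
  shows "\<exists>a\<in>\<rat>. \<exists>b\<in>\<rat>. a < x \<and> x < b \<and> (\<forall>y\<in>{a<..<x}. Q y) \<and> (\<forall>y\<in>{x<..<b}. Q' y)"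
proof -
  obtain a' where a': "a' < x" "\<And>y. a' < y \<Longrightarrow> y < x \<Longrightarrow> Q y"
    using assms(1) by (auto simp: eventually_at_left_field)
  obtain b' where b': "x < b'" "\<And>y. x < y \<Longrightarrow> y < b' \<Longrightarrow> Q' y"
    using assms(2) by (auto simp: eventually_at_right_field)
  obtain a where "a \<in> \<rat>" "a' < a" "a < x" using Rats_dense_in_real[OF a'(1)] by auto
  moreover obtain b where "b \<in> \<rat>" "x < b" "b < b'" using Rats_dense_in_real[OF b'(1)] by auto
  ultimately show ?thesis using a' b' by (intro bexI[of _ a] bexI[of _ b]) auto
qed

text \<open>Label \<open>x\<close> by a rational number strictly between the two limits and a window
  where \<open>g\<close> is below it on the left and above it on the right. At the midpoint of two
  points with one label \<open>g\<close> would be both.\<close>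

lemma countable_left_less_right_limit:
  fixes g :: "real \<Rightarrow> real"
  shows "countable {x. \<exists>l r. (g \<longlongrightarrow> l) (at_left x) \<and> (g \<longlongrightarrow> r) (at_right x) \<and> l < r}"
proof (rule countable_rational_separation[where
      R = "\<lambda>a b r x. (\<forall>y\<in>{a<..<x}. g y < r) \<and> (\<forall>y\<in>{x<..<b}. r < g y)"])
  fix x assume "x \<in> {x. \<exists>l r. (g \<longlongrightarrow> l) (at_left x) \<and> (g \<longlongrightarrow> r) (at_right x) \<and> l < r}"
  then obtain l r where lr: "(g \<longlongrightarrow> l) (at_left x)" "(g \<longlongrightarrow> r) (at_right x)" "l < r" by auto
  obtain c where c: "c \<in> \<rat>" "l < c" "c < r" using Rats_dense_in_real[OF lr(3)] by auto
  show "\<exists>a\<in>\<rat>. \<exists>b\<in>\<rat>. \<exists>r\<in>\<rat>. a < x \<and> x < b \<and> (\<forall>y\<in>{a<..<x}. g y < r) \<and> (\<forall>y\<in>{x<..<b}. r < g y)"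
    using rational_window[OF order_tendstoD(2)[OF lr(1) c(2)] order_tendstoD(1)[OF lr(2) c(3)]] c(1)
    by blast
next
  fix a b r x y :: real
  assume *: "(\<forall>y\<in>{a<..<x}. g y < r) \<and> (\<forall>y\<in>{x<..<b}. r < g y)"
    "(\<forall>z\<in>{a<..<y}. g z < r) \<and> (\<forall>z\<in>{y<..<b}. r < g z)" "a < x" "x < y" "y < b"
  then have "r < g ((x + y) / 2)" "g ((x + y) / 2) < r" by auto
  then show False by simp
qed

lemma countable_left_neq_right_limit:
  fixes g :: "real \<Rightarrow> real"
  shows "countable {x. \<exists>l r. (g \<longlongrightarrow> l) (at_left x) \<and> (g \<longlongrightarrow> r) (at_right x) \<and> l \<noteq> r}"
proof -
  have "{x. \<exists>l r. (g \<longlongrightarrow> l) (at_left x) \<and> (g \<longlongrightarrow> r) (at_right x) \<and> l \<noteq> r} \<subseteq>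
      {x. \<exists>l r. (g \<longlongrightarrow> l) (at_left x) \<and> (g \<longlongrightarrow> r) (at_right x) \<and> l < r} \<union>
      {x. \<exists>l r. ((\<lambda>x. - g x) \<longlongrightarrow> l) (at_left x) \<and> ((\<lambda>x. - g x) \<longlongrightarrow> r) (at_right x) \<and> l < r}"
  proof
    fix x assume "x \<in> {x. \<exists>l r. (g \<longlongrightarrow> l) (at_left x) \<and> (g \<longlongrightarrow> r) (at_right x) \<and> l \<noteq> r}"
    then obtain l r where lr: "(g \<longlongrightarrow> l) (at_left x)" "(g \<longlongrightarrow> r) (at_right x)" "l \<noteq> r" by auto
    then consider "l < r" | "- l < - r" by linarith
    then show "x \<in> {x. \<exists>l r. (g \<longlongrightarrow> l) (at_left x) \<and> (g \<longlongrightarrow> r) (at_right x) \<and> l < r} \<union>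
      {x. \<exists>l r. ((\<lambda>x. - g x) \<longlongrightarrow> l) (at_left x) \<and> ((\<lambda>x. - g x) \<longlongrightarrow> r) (at_right x) \<and> l < r}"
    proof cases
      case 1
      then show ?thesis using lr(1,2) by blast
    next
      case 2
      then have "x \<in> {x. \<exists>l r. ((\<lambda>x. - g x) \<longlongrightarrow> l) (at_left x) \<and> ((\<lambda>x. - g x) \<longlongrightarrow> r) (at_right x) \<and> l < r}"
        using lr(1,2)[THEN tendsto_minus] by blast
      then show ?thesis ..
    qed
  qed
  then show ?thesis
    by (rule countable_subset) (intro countable_Un countable_left_less_right_limit)
qed

text \<open>A rational slope strictly between the one-sided slopes makes \<open>x\<close> the strict
  minimum of \<open>g y - r * y\<close> on a window, and two points cannot both be the strict
  minimum on the same window.\<close>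

lemma countable_left_less_right_derivative:
  fixes g :: "real \<Rightarrow> real"
  shows "countable {x. \<exists>l r. ((\<lambda>y. (g y - g x) / (y - x)) \<longlongrightarrow> l) (at_left x) \<and>
    ((\<lambda>y. (g y - g x) / (y - x)) \<longlongrightarrow> r) (at_right x) \<and> l < r}" (is "countable ?S")
proof (rule countable_rational_separation[where
      R = "\<lambda>a b r x. (\<forall>y\<in>{a<..<x}. g x - r * x < g y - r * y) \<and>
        (\<forall>y\<in>{x<..<b}. g x - r * x < g y - r * y)"])
  fix x assume "x \<in> ?S"
  then obtain l r where lr: "((\<lambda>y. (g y - g x) / (y - x)) \<longlongrightarrow> l) (at_left x)"
    "((\<lambda>y. (g y - g x) / (y - x)) \<longlongrightarrow> r) (at_right x)" "l < r" by auto
  obtain c where c: "c \<in> \<rat>" "l < c" "c < r" using Rats_dense_in_real[OF lr(3)] by auto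
  obtain a b where ab: "a \<in> \<rat>" "b \<in> \<rat>" "a < x" "x < b"
    "\<forall>y\<in>{a<..<x}. (g y - g x) / (y - x) < c" "\<forall>y\<in>{x<..<b}. c < (g y - g x) / (y - x)"
    using rational_window[OF order_tendstoD(2)[OF lr(1) c(2)] order_tendstoD(1)[OF lr(2) c(3)]]
    by blast
  have "g x - c * x < g y - c * y" if "y \<in> {a<..<x}" for y
  proof -
    have "(g y - g x) / (y - x) < c" "y - x < 0" using ab(5) that by auto
    then have "c * (y - x) < g y - g x" by (simp only: neg_divide_less_eq)
    then show ?thesis by (simp add: right_diff_distrib)
  qed
  moreover have "g x - c * x < g y - c * y" if "y \<in> {x<..<b}" for y
  proof -
    have "c < (g y - g x) / (y - x)" "0 < y - x" using ab(6) that by auto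
    then have "c * (y - x) < g y - g x" by (simp only: pos_less_divide_eq)
    then show ?thesis by (simp add: right_diff_distrib)
  qed
  ultimately show "\<exists>a\<in>\<rat>. \<exists>b\<in>\<rat>. \<exists>r\<in>\<rat>. a < x \<and> x < b \<and>
      (\<forall>y\<in>{a<..<x}. g x - r * x < g y - r * y) \<and> (\<forall>y\<in>{x<..<b}. g x - r * x < g y - r * y)"
    using ab(1-4) c(1) by blast
next
  fix a b r x y :: real
  assume "(\<forall>y\<in>{a<..<x}. g x - r * x < g y - r * y) \<and> (\<forall>y\<in>{x<..<b}. g x - r * x < g y - r * y)"
    "(\<forall>z\<in>{a<..<y}. g y - r * y < g z - r * z) \<and> (\<forall>z\<in>{y<..<b}. g y - r * y < g z - r * z)"
    "a < x" "x < y" "y < b"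
  then have "g x - r * x < g y - r * y" "g y - r * y < g x - r * x" by auto
  then show False by simp
qed

lemma countable_left_neq_right_derivative:
  fixes g :: "real \<Rightarrow> real"
  shows "countable {x. \<exists>l r. ((\<lambda>y. (g y - g x) / (y - x)) \<longlongrightarrow> l) (at_left x) \<and>
    ((\<lambda>y. (g y - g x) / (y - x)) \<longlongrightarrow> r) (at_right x) \<and> l \<noteq> r}" (is "countable ?S")
proof -
  let ?T = "\<lambda>g. {x. \<exists>l r. ((\<lambda>y. (g y - g x) / (y - x)) \<longlongrightarrow> l) (at_left x) \<and>
    ((\<lambda>y. (g y - g x) / (y - x)) \<longlongrightarrow> r) (at_right x) \<and> l < r} :: real set"
  have "?S \<subseteq> ?T g \<union> ?T (\<lambda>y. - g y)"
  proof
    fix x assume "x \<in> ?S"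
    then obtain l r where lr: "((\<lambda>y. (g y - g x) / (y - x)) \<longlongrightarrow> l) (at_left x)"
      "((\<lambda>y. (g y - g x) / (y - x)) \<longlongrightarrow> r) (at_right x)" "l \<noteq> r" by auto
    have eq: "- ((g y - g x) / (y - x)) = (- g y - - g x) / (y - x)" for y
      by (simp add: minus_divide_left)
    consider "l < r" | "- l < - r" using lr(3) by linarith
    then show "x \<in> ?T g \<union> ?T (\<lambda>y. - g y)"
    proof cases
      case 1
      then show ?thesis using lr(1,2) by blast
    next
      case 2
      then have "x \<in> ?T (\<lambda>y. - g y)" using lr(1,2)[THEN tendsto_minus, unfolded eq] by blast
      then show ?thesis ..
    qed
  qed
  then show ?thesis
    by (rule countable_subset) (intro countable_Un countable_left_less_right_derivative)
qed

subsection \<open>Specular derivatives on the line\<close>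

lemma filterlim_shift_right:
  fixes s :: real
  shows "filterlim f F (at_right s) \<longleftrightarrow> filterlim (\<lambda>h. f (s + h)) F (at_right 0)"
  by (subst filterlim_at_right_to_0) (simp add: add.commute)

lemma filterlim_shift_left:
  fixes s :: real
  shows "filterlim f F (at_left s) \<longleftrightarrow> filterlim (\<lambda>h. f (s + h)) F (at_left 0)"
  by (simp add: filterlim_at_left_to_right filterlim_at_right_to_0[of _ _ "- s"] add.commute)

text \<open>Continuity forces the reference value \<open>c\<close>, a one-sided limit, to be
  \<open>g s\<close>, so the one-sided slopes are the ordinary ones.\<close>

lemma has_specular_derivative_real_quotients:
  assumes "has_specular_derivative UNIV g (1::real) s d" "isCont g s"
  obtains \<alpha> \<beta> where "((\<lambda>y. (g y - g s) / (y - s)) \<longlongrightarrow> \<alpha>) (at_right s)"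
    "((\<lambda>y. (g y - g s) / (y - s)) \<longlongrightarrow> \<beta>) (at_left s)" "d = specular_mean \<alpha> \<beta>"
proof -
  have sides: "right_side UNIV (1::real) s = at_right 0" "left_side UNIV (1::real) s = at_left 0"
    by (simp_all add: right_side_open left_side_open)
  from assms(1) obtain c \<alpha> \<beta> where c: "((\<lambda>h. g (s + h)) \<longlongrightarrow> c) (at_right 0)"
    and q: "((\<lambda>h. (g (s + h) - c) / h) \<longlongrightarrow> \<alpha>) (at_right 0)"
      "((\<lambda>h. (g (s + h) - c) / h) \<longlongrightarrow> \<beta>) (at_left 0)" "d = specular_mean \<alpha> \<beta>"
    unfolding has_specular_derivative_def has_right_limit_def has_left_limit_def sides by auto
  have "(g \<longlongrightarrow> c) (at_right s)" using c by (simp add: filterlim_shift_right[of _ _ s])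
  moreover have "(g \<longlongrightarrow> g s) (at_right s)"
    using assms(2) by (simp add: isCont_def filterlim_at_split)
  ultimately have "c = g s" using tendsto_unique[of "at_right s" g c "g s"] by simp
  then show thesis
    using q by (intro that[of \<alpha> \<beta>]) (simp_all add: filterlim_shift_right[of _ _ s] filterlim_shift_left[of _ _ s])
qed

lemma has_real_derivative_from_sides:
  fixes g :: "real \<Rightarrow> real"
  assumes "((\<lambda>y. (g y - g s) / (y - s)) \<longlongrightarrow> d) (at_right s)"
    "((\<lambda>y. (g y - g s) / (y - s)) \<longlongrightarrow> d) (at_left s)"
  shows "(g has_real_derivative d) (at s)"
  using assms by (simp add: has_field_derivative_iff filterlim_at_split)

text \<open>The exceptional points are the corners, where the one-sided slopes differ; elsewhere the
  specular mean of two equal slopes is the classical derivative.\<close>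

lemma specular_derivative_classical_off_countable:
  assumes cont: "continuous_on {a..b} g"
    and spec: "\<And>s. s \<in> {a<..<b} \<Longrightarrow> has_specular_derivative UNIV g (1::real) s (g' s)"
  obtains S where "countable S" "\<And>s. s \<in> {a<..<b} - S \<Longrightarrow> (g has_real_derivative g' s) (at s)"
proof
  let ?S = "{x. \<exists>l r. ((\<lambda>y. (g y - g x) / (y - x)) \<longlongrightarrow> l) (at_left x) \<and>
    ((\<lambda>y. (g y - g x) / (y - x)) \<longlongrightarrow> r) (at_right x) \<and> l \<noteq> r}"
  show "countable ?S" by (rule countable_left_neq_right_derivative)
  fix s assume s: "s \<in> {a<..<b} - ?S"
  then have "isCont g s"
    using continuous_on_interior[OF cont, of s] by (simp add: interior_atLeastAtMost_real)
  then obtain \<alpha> \<beta> where *: "((\<lambda>y. (g y - g s) / (y - s)) \<longlongrightarrow> \<alpha>) (at_right s)"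
    "((\<lambda>y. (g y - g s) / (y - s)) \<longlongrightarrow> \<beta>) (at_left s)" "g' s = specular_mean \<alpha> \<beta>"
    using has_specular_derivative_real_quotients spec s by blast
  then have "\<alpha> = \<beta>" using s by blast
  then show "(g has_real_derivative g' s) (at s)"
    using * by (simp add: has_real_derivative_from_sides specular_mean_same)
qed

lemma specular_fundamental_theorem_of_calculus:
  assumes "a \<le> b" "continuous_on {a..b} g"
    and "\<And>s. s \<in> {a<..<b} \<Longrightarrow> has_specular_derivative UNIV g (1::real) s (g' s)"
  shows "(g' has_integral (g b - g a)) {a..b}"
proof -
  obtain S where "countable S" "\<And>s. s \<in> {a<..<b} - S \<Longrightarrow> (g has_real_derivative g' s) (at s)"
    using specular_derivative_classical_off_countable[OF assms(2,3)] by blast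
  then show ?thesis
    using fundamental_theorem_of_calculus_countable[OF _ assms(1,2), of S g']
    by (simp add: has_real_derivative_iff_has_vector_derivative)
qed

text \<open>A specular derivative can skip the mean slope, as for the absolute value on [-1, 2], so
  there is no mean value point to appeal to. The bound comes from integrating the derivative, which
  tolerates a countable set \<open>N\<close> of uncontrolled values.\<close>

lemma specular_mean_value_estimate:
  assumes "a \<le> b" "continuous_on {a..b} g"
    and "\<And>s. s \<in> {a<..<b} \<Longrightarrow> has_specular_derivative UNIV g (1::real) s (g' s)"
    and "countable N" "\<And>s. s \<in> {a<..<b} - N \<Longrightarrow> \<bar>g' s - m\<bar> \<le> \<epsilon>" "0 \<le> \<epsilon>"
  shows "\<bar>g b - g a - m * (b - a)\<bar> \<le> \<epsilon> * (b - a)"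
proof -
  obtain S where S: "countable S" "\<And>s. s \<in> {a<..<b} - S \<Longrightarrow> (g has_real_derivative g' s) (at s)"
    using specular_derivative_classical_off_countable[OF assms(2,3)] by blast
  define T where "T = N \<union> S"
  \<comment> \<open>Replacing the derivative by \<open>m\<close> at the exceptional points leaves
    the integral unchanged and makes the bound on \<open>f s - m\<close> hold everywhere.\<close>
  define f where "f s = (if s \<in> {a<..<b} - T then g' s else m)" for s
  have "(f has_integral (g b - g a)) {a..b}"
  proof (rule fundamental_theorem_of_calculus_countable)
    show "countable T" using S(1) assms(4) by (simp add: T_def)
    show "(g has_vector_derivative f s) (at s)" if "s \<in> {a<..<b} - T" for s
      using S(2)[of s] that
      by (simp add: f_def T_def has_real_derivative_iff_has_vector_derivative)
  qed (use assms in auto)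
  moreover have "((\<lambda>_. m) has_integral m * (b - a)) {a..b}"
    using has_integral_const_real[of m a b] assms(1) by (simp add: mult.commute)
  ultimately have "((\<lambda>s. f s - m) has_integral (g b - g a - m * (b - a))) (cbox a b)"
    by (simp add: has_integral_diff)
  moreover have "norm (f s - m) \<le> \<epsilon>" for s using assms(5,6) by (auto simp: f_def T_def)
  ultimately have "norm (g b - g a - m * (b - a)) \<le> \<epsilon> * measure lborel (cbox a b)"
    using has_integral_bound[OF assms(6)] by blast
  then show ?thesis using assms(1) by simp
qed

text \<open>A corner is incompatible with continuity of \<open>g'\<close>: the estimate with
  \<open>m = g' z\<close> on intervals that begin or end at \<open>z\<close> gives the same slope on
  both sides.\<close>

lemma specular_derivative_classical:
  assumes cont: "continuous_on {a..b} g"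
    and spec: "\<And>s. s \<in> {a<..<b} \<Longrightarrow> has_specular_derivative UNIV g (1::real) s (g' s)"
    and "z \<in> {a<..<b}" "isCont g' z"
  shows "(g has_real_derivative g' z) (at z)"
  unfolding has_field_derivative_def has_derivative_at_alt
proof (intro conjI allI impI)
  show "bounded_linear ((*) (g' z))" by (rule bounded_linear_mult_right)
  fix e :: real assume "e > 0"
  then obtain d where d: "d > 0" "\<And>y. dist y z < d \<Longrightarrow> dist (g' y) (g' z) < e"
    using assms(4) unfolding continuous_at_eps_delta by blast
  define \<delta> where "\<delta> = min d (min (z - a) (b - z))"
  have est: "\<bar>g v - g u - g' z * (v - u)\<bar> \<le> e * (v - u)"
    if "u \<le> v" "z - \<delta> < u" "v < z + \<delta>" for u v
  proof (rule specular_mean_value_estimate[OF that(1), where N = "{}"])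
    have sub: "{u..v} \<subseteq> {a..b}" "{u<..<v} \<subseteq> {a<..<b}" using that by (auto simp: \<delta>_def)
    show "continuous_on {u..v} g" using continuous_on_subset[OF cont sub(1)] .
    show "has_specular_derivative UNIV g 1 s (g' s)" if "s \<in> {u<..<v}" for s
      using spec sub(2) that by blast
    show "\<bar>g' s - g' z\<bar> \<le> e" if "s \<in> {u<..<v} - {}" for s
    proof -
      have "dist s z < d" using that \<open>z - \<delta> < u\<close> \<open>v < z + \<delta>\<close> by (auto simp: dist_real_def \<delta>_def)
      then show ?thesis using d(2) by (fastforce simp: dist_real_def)
    qed
  qed (use \<open>e > 0\<close> in auto)
  show "\<exists>d>0. \<forall>y. norm (y - z) < d \<longrightarrow> norm (g y - g z - g' z * (y - z)) \<le> e * norm (y - z)"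
  proof (intro exI[of _ \<delta>] conjI allI impI)
    show "\<delta> > 0" using d(1) assms(3) by (simp add: \<delta>_def)
    fix y assume "norm (y - z) < \<delta>"
    then have y: "z - \<delta> < y" "y < z + \<delta>" by auto
    consider "z \<le> y" | "y \<le> z" by linarith
    then show "norm (g y - g z - g' z * (y - z)) \<le> e * norm (y - z)"
    proof cases
      case 1
      then show ?thesis using est[of z y] y \<open>\<delta> > 0\<close> by simp
    next
      case 2
      have "norm (g y - g z - g' z * (y - z)) = \<bar>g z - g y - g' z * (z - y)\<bar>"
        by (simp add: algebra_simps abs_minus_commute)
      then show ?thesis using est[of y z] y \<open>\<delta> > 0\<close> 2 by simp
    qed
  qed
qed

text \<open>Bisection glues local step functions, equal to the two limits beside a point and to
  \<open>g\<close> at it, into uniform approximations. This serves the rows of \<open>f\<close>,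
  also at the exceptional levels.\<close>

lemma integrable_on_regulated:
  fixes g :: "real \<Rightarrow> real"
  assumes "\<And>x. x \<in> {a..b} \<Longrightarrow> \<exists>l r. (g \<longlongrightarrow> l) (at_left x) \<and> (g \<longlongrightarrow> r) (at_right x)"
  shows "g integrable_on {a..b}"
proof (cases "a \<le> b")
  case True
  have "\<exists>h. (\<forall>x\<in>{a..b}. norm (g x - h x) \<le> e) \<and> h integrable_on {a..b}" if e: "e > 0" for e
  proof -
    define P where "P u v \<longleftrightarrow> (a \<le> u \<and> v \<le> b \<longrightarrow>
      (\<exists>h. (\<forall>x\<in>{u..v}. norm (g x - h x) \<le> e) \<and> h integrable_on {u..v}))" for u v
    have spike: "h integrable_on {u..v}" if "k integrable_on {u..v}" "finite F"
      "\<And>x. x \<in> {u..v} - F \<Longrightarrow> h x = k x" for h k :: "real \<Rightarrow> real" and u v F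
      using integrable_spike_finite[OF that(2) _ that(1), of h] that(3) by auto
    from True have "P a b"
    proof (induction rule: Bolzano)
      case (trans u v w)
      show ?case unfolding P_def
      proof
        assume "a \<le> u \<and> w \<le> b"
        then obtain h k where h: "\<forall>x\<in>{u..v}. norm (g x - h x) \<le> e" "h integrable_on {u..v}"
          and k: "\<forall>x\<in>{v..w}. norm (g x - k x) \<le> e" "k integrable_on {v..w}"
          using trans unfolding P_def by (meson order_trans)
        let ?m = "\<lambda>x. if x \<le> v then h x else k x"
        have "?m integrable_on {u..v}" by (rule spike[OF h(2), of "{}"]) auto
        moreover have "?m integrable_on {v..w}" by (rule spike[OF k(2), of "{v}"]) auto
        ultimately have "?m integrable_on {u..w}"
          using Henstock_Kurzweil_Integration.integrable_combine trans(3,4) by blast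
        moreover have "\<forall>x\<in>{u..w}. norm (g x - ?m x) \<le> e" using h(1) k(1) by auto
        ultimately show "\<exists>h. (\<forall>x\<in>{u..w}. norm (g x - h x) \<le> e) \<and> h integrable_on {u..w}"
          by (intro exI[of _ ?m] conjI)
      qed
    next
      case (local x)
      then obtain l r where lr: "(g \<longlongrightarrow> l) (at_left x)" "(g \<longlongrightarrow> r) (at_right x)"
        using assms[of x] by auto
      obtain a' where a': "a' < x" "\<And>y. a' < y \<Longrightarrow> y < x \<Longrightarrow> dist (g y) l < e"
        using tendstoD[OF lr(1) e] by (auto simp: eventually_at_left_field)
      obtain b' where b': "x < b'" "\<And>y. x < y \<Longrightarrow> y < b' \<Longrightarrow> dist (g y) r < e"
        using tendstoD[OF lr(2) e] by (auto simp: eventually_at_right_field)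
      show ?case
      proof (intro exI[of _ "min (x - a') (b' - x)"] conjI allI impI)
        show "0 < min (x - a') (b' - x)" using a' b' by simp
        fix u v assume uv: "u \<le> x \<and> x \<le> v \<and> v - u < min (x - a') (b' - x)"
        let ?m = "\<lambda>y. if y < x then l else if y = x then g x else r"
        have "?m integrable_on {u..x}" by (rule spike[OF integrable_const_ivl[of l], of "{x}"]) auto
        moreover have "?m integrable_on {x..v}"
          by (rule spike[OF integrable_const_ivl[of r], of "{x}"]) auto
        ultimately have "?m integrable_on {u..v}"
          using Henstock_Kurzweil_Integration.integrable_combine uv by blast
        moreover have "norm (g y - ?m y) \<le> e" if "y \<in> {u..v}" for y
          using a'(2)[of y] b'(2)[of y] that uv \<open>e > 0\<close> by (auto simp: dist_real_def)
        ultimately show "P u v" unfolding P_def by (intro impI exI[of _ ?m] conjI ballI)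
      qed
    qed
    then show ?thesis by (simp add: P_def)
  qed
  then show ?thesis using integrable_uniform_limit[of a b g] by simp
qed (simp add: integrable_on_empty)

text \<open>Total differentiability is not assumed. The slanted move is split into a vertical one,
  where only the derivative at \<open>s\<close> is known, and a horizontal one at level
  \<open>\<sigma>\<close>, governed by the continuity of \<open>w\<close> at the base point.\<close>

lemma has_real_derivative_slanted:
  fixes g w :: "real \<times> real \<Rightarrow> real"
  assumes dt: "((\<lambda>\<sigma>. g (y, \<sigma>)) has_real_derivative p) (at s)"
    and U: "open U" "(y, s) \<in> U"
    and dx: "\<And>\<eta> \<sigma>. (\<eta>, \<sigma>) \<in> U \<Longrightarrow> ((\<lambda>\<eta>. g (\<eta>, \<sigma>)) has_real_derivative w (\<eta>, \<sigma>)) (at \<eta>)"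
    and w: "isCont w (y, s)"
  shows "((\<lambda>\<sigma>. g (y + k * (\<sigma> - s), \<sigma>)) has_real_derivative p + k * w (y, s)) (at s)"
proof -
  let ?D = "\<lambda>\<sigma>. g (y + k * (\<sigma> - s), \<sigma>) - g (y, \<sigma>)"
  have "(?D has_real_derivative k * w (y, s)) (at s)"
    unfolding has_field_derivative_def has_derivative_at_alt
  proof (intro conjI allI impI)
    show "bounded_linear ((*) (k * w (y, s)))" by (rule bounded_linear_mult_right)
    fix e :: real assume "e > 0"
    define \<epsilon> where "\<epsilon> = e / (\<bar>k\<bar> + 1)"
    have \<epsilon>: "\<epsilon> > 0" "\<epsilon> * \<bar>k\<bar> \<le> e"
      using \<open>e > 0\<close> by (auto simp: \<epsilon>_def field_simps)
    obtain r1 where r1: "r1 > 0" "ball (y, s) r1 \<subseteq> U" using U open_contains_ball by blast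
    obtain r2 where r2: "r2 > 0" "\<And>z. dist z (y, s) < r2 \<Longrightarrow> dist (w z) (w (y, s)) < \<epsilon>"
      using w \<epsilon>(1) unfolding continuous_at_eps_delta by blast
    \<comment> \<open>A change of height by \<open>h\<close> on the slanted line moves the point by
      at most \<open>(\<bar>k\<bar> + 1) * \<bar>h\<bar>\<close>.\<close>
    define d where "d = min r1 r2 / (\<bar>k\<bar> + 1)"
    have "d > 0" using r1 r2 by (simp add: d_def)
    show "\<exists>d>0. \<forall>\<sigma>. norm (\<sigma> - s) < d \<longrightarrow>
        norm (?D \<sigma> - ?D s - k * w (y, s) * (\<sigma> - s)) \<le> e * norm (\<sigma> - s)"
    proof (intro exI[of _ d] conjI allI impI \<open>d > 0\<close>)
      fix \<sigma> assume "norm (\<sigma> - s) < d"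
      then have \<sigma>: "(\<bar>k\<bar> + 1) * \<bar>\<sigma> - s\<bar> < min r1 r2" by (simp add: d_def field_simps)
      define y' where "y' = y + k * (\<sigma> - s)"
      define I where "I = closed_segment y y'"
      have near: "dist (\<eta>, \<sigma>) (y, s) < min r1 r2" if "\<eta> \<in> I" for \<eta>
      proof -
        have "\<bar>\<eta> - y\<bar> \<le> \<bar>k * (\<sigma> - s)\<bar>"
          using that by (auto simp: I_def y'_def closed_segment_eq_real_ivl split: if_splits)
        then have "\<bar>\<eta> - y\<bar> + \<bar>\<sigma> - s\<bar> \<le> (\<bar>k\<bar> + 1) * \<bar>\<sigma> - s\<bar>"
          unfolding abs_mult by (simp add: distrib_right)
        moreover have "dist (\<eta>, \<sigma>) (y, s) \<le> \<bar>\<eta> - y\<bar> + \<bar>\<sigma> - s\<bar>"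
          unfolding dist_Pair_Pair dist_real_def by (rule sqrt_sum_squares_le_sum_abs[THEN order_trans]) simp
        ultimately show ?thesis using \<sigma> by linarith
      qed
      \<comment> \<open>Subtracting the linear function of slope \<open>w (y, s)\<close> leaves a
        horizontal derivative of size at most \<open>\<epsilon>\<close>, so the mean value
        inequality bounds the remainder.\<close>
      have "norm ((g (y', \<sigma>) - w (y, s) * y') - (g (y, \<sigma>) - w (y, s) * y)) \<le> \<epsilon> * norm (y' - y)"
      proof (rule field_differentiable_bound[where S = I and f' = "\<lambda>\<eta>. w (\<eta>, \<sigma>) - w (y, s)"])
        show "convex I" "y' \<in> I" "y \<in> I" by (simp_all add: I_def)
        fix \<eta> assume "\<eta> \<in> I"
        then have "(\<eta>, \<sigma>) \<in> U" "dist (w (\<eta>, \<sigma>)) (w (y, s)) < \<epsilon>"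
          using near r1(2) r2(2) by (auto simp: dist_commute subset_iff)
        then show "norm (w (\<eta>, \<sigma>) - w (y, s)) \<le> \<epsilon>"
          and "((\<lambda>\<eta>. g (\<eta>, \<sigma>) - w (y, s) * \<eta>) has_real_derivative w (\<eta>, \<sigma>) - w (y, s)) (at \<eta> within I)"
          by (auto simp: dist_real_def intro!: derivative_eq_intros DERIV_subset[OF dx])
      qed
      also have "\<dots> = (\<epsilon> * \<bar>k\<bar>) * \<bar>\<sigma> - s\<bar>" by (simp add: y'_def abs_mult)
      also have "\<dots> \<le> e * \<bar>\<sigma> - s\<bar>" using \<epsilon> by (intro mult_right_mono) auto
      finally show "norm (?D \<sigma> - ?D s - k * w (y, s) * (\<sigma> - s)) \<le> e * norm (\<sigma> - s)"
        by (simp add: y'_def algebra_simps)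
    qed
  qed
  from DERIV_add[OF dt this] show ?thesis by simp
qed

subsection \<open>Singular hyperplanes of the second time derivative\<close>

text \<open>Otherwise the complements of the sets in \<open>\<A>\<close> would be open and dense in
  the interval, hence have a dense intersection by Baire; but the cover makes that intersection
  empty.\<close>

lemma closed_cover_contains_interval:
  fixes a b :: real
  assumes "a < b" "countable \<A>" "\<And>A. A \<in> \<A> \<Longrightarrow> closed A" "{a..b} \<subseteq> \<Union>\<A>"
  obtains A u v where "A \<in> \<A>" "u < v" "{u..v} \<subseteq> A" "{u..v} \<subseteq> {a..b}"
proof -
  have "\<exists>A\<in>\<A>. \<not> {a..b} \<subseteq> closure ({a..b} - A)"
  proof (rule ccontr)
    assume dense: "\<not> ?thesis"
    have "{a..b} \<subseteq> closure (\<Inter>((\<lambda>A. {a..b} - A) ` \<A>))"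
    proof (intro Baire conjI)
      fix T assume T: "T \<in> (\<lambda>A. {a..b} - A) ` \<A>"
      then obtain A where "A \<in> \<A>" "T = {a..b} \<inter> - A" by auto
      then show "openin (top_of_set {a..b}) T"
        using assms(3) by (simp only: openin_open_Int open_Compl)
      show "{a..b} \<subseteq> closure T" using T dense by blast
    qed (use assms(2) in auto)
    moreover have "\<A> \<noteq> {}" using assms(1,4) by auto
    then have "\<Inter>((\<lambda>A. {a..b} - A) ` \<A>) = {}" using assms(4) by auto
    ultimately show False using assms(1) by simp
  qed
  then obtain A x where A: "A \<in> \<A>" and x: "x \<in> {a..b}" "x \<notin> closure ({a..b} - A)" by blast
  then obtain \<epsilon> where \<epsilon>: "\<epsilon> > 0" "\<And>y. y \<in> {a..b} - A \<Longrightarrow> \<epsilon> \<le> dist y x"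
    unfolding closure_approachable by (meson not_le)
  define u v where "u = max a (x - \<epsilon>/2)" and "v = min b (x + \<epsilon>/2)"
  have "u < v" "{u..v} \<subseteq> {a..b}" using x(1) \<epsilon>(1) assms(1) by (auto simp: u_def v_def)
  moreover have "{u..v} \<subseteq> A"
  proof
    fix y assume "y \<in> {u..v}"
    then have "y \<in> {a..b}" "dist y x < \<epsilon>" using \<epsilon>(1) by (auto simp: u_def v_def dist_real_def)
    then show "y \<in> A" using \<epsilon>(2)[of y] by force
  qed
  ultimately show thesis using that A by blast
qed

text \<open>
  By Baire the jump has a constant sign and is bounded below on a subinterval, along which the
  difference of the values of \<open>P\<close> on the two sides of the line would have to grow.
\<close>

lemma no_transverse_jump:
  fixes P g :: "real \<times> real \<Rightarrow> real" and k d :: real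
  assumes z_def: "z = (\<lambda>s. (d + k * s, s))"
    and U: "open U" "s1 < s0" "s0 < s2" "z s0 \<in> U"
    and P: "continuous_on U P"
    and g: "continuous_on (U - range z) g"
    and deriv: "\<And>y s. (y, s) \<in> U - range z \<Longrightarrow>
      ((\<lambda>\<sigma>. P (y + k * (\<sigma> - s), \<sigma>)) has_real_derivative g (y, s)) (at s)"
    and e: "fst e \<noteq> k * snd e"
    and jump: "\<And>s. s \<in> {s1..s2} \<Longrightarrow> \<exists>l r. ((\<lambda>h. g (z s + h *\<^sub>R e)) \<longlongrightarrow> l) (at_left 0) \<and>
      ((\<lambda>h. g (z s + h *\<^sub>R e)) \<longlongrightarrow> r) (at_right 0) \<and> l \<noteq> r"
  shows False
proof -
  obtain \<rho> where \<rho>: "\<rho> > 0" "cball (z s0) \<rho> \<subseteq> U" using U open_contains_cball by blast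
  have unif: "uniformly_continuous_on (cball (z s0) \<rho>) P"
    by (rule compact_uniformly_continuous[OF continuous_on_subset[OF P \<rho>(2)]]) simp
  have pos: "norm (k, 1::real) + norm e > 0" by (intro add_pos_nonneg) (auto simp: zero_prod_def)
  \<comment> \<open>Chosen so that all \<open>z s + h *\<^sub>R e\<close> with
    \<open>\<bar>s - s0\<bar>\<close> and \<open>\<bar>h\<bar>\<close> at most
    \<open>\<delta>\<close> lie in the ball, for \<open>s\<close> in the range where the jump is
    known.\<close>
  define \<delta> where "\<delta> = min (min (s0 - s1) (s2 - s0)) (\<rho> / (norm (k, 1::real) + norm e))"
  have "\<delta> \<le> \<rho> / (norm (k, 1::real) + norm e)" by (simp add: \<delta>_def)
  then have "\<delta> * (norm (k, 1::real) + norm e) \<le> \<rho>" using pos by (simp add: pos_le_divide_eq)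
  then have \<delta>: "\<delta> > 0" "\<delta> \<le> s0 - s1" "\<delta> \<le> s2 - s0" "\<delta> * (norm (k, 1::real) + norm e) \<le> \<rho>"
    using U \<rho>(1) pos by (simp_all add: \<delta>_def)
  define a b where "a = s0 - \<delta>" and "b = s0 + \<delta>"
  have inK: "z s + h *\<^sub>R e \<in> cball (z s0) \<rho>" if "s \<in> {a..b}" "\<bar>h\<bar> \<le> \<delta>" for s h
  proof -
    have "z s + h *\<^sub>R e - z s0 = (s - s0) *\<^sub>R (k, 1) + h *\<^sub>R e"
      by (simp add: z_def prod_eq_iff algebra_simps)
    then have "norm (z s + h *\<^sub>R e - z s0) \<le> \<bar>s - s0\<bar> * norm (k, 1::real) + \<bar>h\<bar> * norm e"
      by (metis norm_triangle_ineq norm_scaleR)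
    also have "\<dots> \<le> \<delta> * norm (k, 1::real) + \<delta> * norm e"
      using that by (intro add_mono mult_right_mono) (auto simp: a_def b_def)
    also have "\<dots> \<le> \<rho>" using \<delta>(4) by (simp add: distrib_left)
    finally show ?thesis by (simp add: dist_norm norm_minus_commute)
  qed
  have off: "z s + h *\<^sub>R e \<notin> range z" if "h \<noteq> 0" for s h
  proof
    assume "z s + h *\<^sub>R e \<in> range z"
    then have "h * (fst e - k * snd e) = 0"
      by (auto simp: z_def prod_eq_iff algebra_simps)
    then show False using that e by simp
  qed
  define \<eta> where "\<eta> m = \<delta> / real (Suc m)" for m
  have \<eta>: "0 < \<eta> m" "\<eta> m \<le> \<delta>" for m
    using \<delta>(1) by (auto simp: \<eta>_def field_simps)
  have \<eta>0: "\<eta> \<longlonglongrightarrow> 0"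
    unfolding \<eta>_def using LIMSEQ_Suc[OF lim_const_over_n[of \<delta>]] by simp
  define G where "G h s = g (z s + h *\<^sub>R e)" for h s
  define J where "J m s = G (\<eta> m) s - G (- \<eta> m) s" for m s
  have contG: "continuous_on {a..b} (G h)" if "h \<noteq> 0" "\<bar>h\<bar> \<le> \<delta>" for h
    unfolding G_def
  proof (rule continuous_on_compose2[OF g])
    show "continuous_on {a..b} (\<lambda>s. z s + h *\<^sub>R e)" unfolding z_def by (intro continuous_intros)
    show "(\<lambda>s. z s + h *\<^sub>R e) ` {a..b} \<subseteq> U - range z"
      by (intro image_subsetI DiffI off[OF that(1)] subsetD[OF \<rho>(2) inK[OF _ that(2)]])
  qed
  have contJ: "continuous_on {a..b} (J m)" for m
    unfolding J_def using \<eta>[of m] by (intro continuous_on_diff contG) auto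
  \<comment> \<open>The bound is demanded of every offset \<open>\<eta> m\<close> with
    \<open>m \<ge> n\<close> rather than of the limits. This makes the set closed although the jump
    need not depend continuously on \<open>s\<close>. The sign of the jump is
    \<open>\<tau>\<close>.\<close>
  define A where "A \<tau> n = {s \<in> {a..b}. \<forall>m\<ge>n. 1 / real (Suc n) \<le> \<tau> * J m s}" for \<tau> n
  have closedA: "closed (A \<tau> n)" for \<tau> n
  proof -
    have "A \<tau> n = (\<Inter>m\<in>{n..}. {s \<in> {a..b}. 1 / real (Suc n) \<le> \<tau> * J m s})"
      by (auto simp: A_def)
    moreover have "closed {s \<in> {a..b}. 1 / real (Suc n) \<le> \<tau> * J m s}" for m
      by (intro continuous_on_closed_Collect_le continuous_intros contJ) auto
    ultimately show ?thesis by (simp add: closed_INT)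
  qed
  have cover: "{a..b} \<subseteq> \<Union>((\<lambda>(\<tau>, n). A \<tau> n) ` ({1, -1} \<times> UNIV))"
  proof
    fix s assume s: "s \<in> {a..b}"
    then have "s \<in> {s1..s2}" using \<delta> by (auto simp: a_def b_def)
    then obtain l r where lr: "((\<lambda>h. G h s) \<longlongrightarrow> l) (at_left 0)" "((\<lambda>h. G h s) \<longlongrightarrow> r) (at_right 0)"
      "l \<noteq> r" using jump unfolding G_def by blast
    have "filterlim \<eta> (at_right 0) sequentially"
      by (rule tendsto_imp_filterlim_at_right[OF \<eta>0]) (simp add: \<eta>(1))
    moreover have "filterlim (\<lambda>m. - \<eta> m) (at_left 0) sequentially"
      by (rule tendsto_imp_filterlim_at_left) (use tendsto_minus[OF \<eta>0] in \<open>simp_all add: \<eta>(1)\<close>)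
    ultimately have "(\<lambda>m. J m s) \<longlonglongrightarrow> r - l"
      unfolding J_def
      by (intro tendsto_diff filterlim_compose[OF lr(1)] filterlim_compose[OF lr(2)])
    then have lim: "(\<lambda>m. sgn (r - l) * J m s) \<longlonglongrightarrow> sgn (r - l) * (r - l)"
      by (intro tendsto_mult tendsto_const)
    have posl: "0 < sgn (r - l) * (r - l)" using lr(3) by (auto simp: sgn_if)
    obtain n1 where n1: "1 / real (Suc n1) < sgn (r - l) * (r - l)" using nat_approx_posE[OF posl] by blast
    obtain n2 where n2: "\<And>m. m \<ge> n2 \<Longrightarrow> 1 / real (Suc n1) < sgn (r - l) * J m s"
      using order_tendstoD(1)[OF lim n1] by (auto simp: eventually_sequentially)
    \<comment> \<open>One index stands both for the size of the jump and for the offset from which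
      it is visible, hence the maximum.\<close>
    have "s \<in> A (sgn (r - l)) (max n1 n2)"
    proof -
      have "1 / real (Suc (max n1 n2)) \<le> sgn (r - l) * J m s" if "m \<ge> max n1 n2" for m
      proof -
        have "1 / real (Suc (max n1 n2)) \<le> 1 / real (Suc n1)" by (intro divide_left_mono) auto
        then show ?thesis using n2[of m] that by simp
      qed
      then show ?thesis using s by (simp add: A_def)
    qed
    moreover have "sgn (r - l) \<in> {1, -1}" using lr(3) by (auto simp: sgn_if)
    ultimately show "s \<in> \<Union>((\<lambda>(\<tau>, n). A \<tau> n) ` ({1, -1} \<times> UNIV))" by blast
  qed
  have "a < b" using \<delta>(1) by (simp add: a_def b_def)
  obtain A' u v where A': "A' \<in> (\<lambda>(\<tau>, n). A \<tau> n) ` ({1, -1} \<times> UNIV)"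
    and uv: "u < v" "{u..v} \<subseteq> A'" "{u..v} \<subseteq> {a..b}"
  proof (rule closed_cover_contains_interval[OF \<open>a < b\<close> _ _ cover])
    show "countable ((\<lambda>(\<tau>, n). A \<tau> n) ` ({1, -1} \<times> UNIV))" by (intro countable_image countable_SIGMA) auto
  qed (use closedA in auto)
  then obtain \<tau> n where "\<tau> \<in> {1, -1}" and An: "{u..v} \<subseteq> A \<tau> n" by auto
  then have \<tau>: "\<bar>\<tau>\<bar> = 1" by auto
  \<comment> \<open>By \<open>An\<close> the function \<open>\<Phi>\<close> below must change by at
    least \<open>\<kappa>\<close> on \<open>{u..v}\<close>, while uniform continuity of
    \<open>P\<close> keeps it below \<open>\<kappa> / 2\<close> in absolute value.\<close>
  define \<kappa> where "\<kappa> = (v - u) / real (Suc n)"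
  have \<kappa>: "\<kappa> > 0" using uv(1) by (simp add: \<kappa>_def)
  obtain \<theta> where \<theta>: "\<theta> > 0" "\<And>x y. x \<in> cball (z s0) \<rho> \<Longrightarrow> y \<in> cball (z s0) \<rho> \<Longrightarrow> dist y x < \<theta> \<Longrightarrow>
      dist (P y) (P x) < \<kappa> / 2"
    using unif half_gt_zero[OF \<kappa>] unfolding uniformly_continuous_on_def by metis
  have "(\<lambda>m. 2 * \<eta> m * norm e) \<longlonglongrightarrow> 0"
    using tendsto_mult[OF tendsto_mult[OF tendsto_const \<eta>0] tendsto_const, of 2 "norm e"] by simp
  then obtain m0 where "\<And>m. m \<ge> m0 \<Longrightarrow> 2 * \<eta> m * norm e < \<theta>"
    using order_tendstoD(2)[OF _ \<theta>(1)] by (force simp: eventually_sequentially)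
  then obtain m where m: "m \<ge> n" "2 * \<eta> m * norm e < \<theta>" by (meson max.cobounded1 max.cobounded2)
  \<comment> \<open>\<open>P\<close> is compared on two parallels of the line, one on each side.
    Both avoid the line, so \<open>\<Phi>\<close> is differentiable with derivative
    \<open>J m\<close>.\<close>
  define \<Phi> where "\<Phi> s = P (z s + \<eta> m *\<^sub>R e) - P (z s + (- \<eta> m) *\<^sub>R e)" for s
  have small: "\<bar>\<Phi> s\<bar> < \<kappa> / 2" if "s \<in> {a..b}" for s
  proof -
    have "norm ((z s + \<eta> m *\<^sub>R e) - (z s + (- \<eta> m) *\<^sub>R e)) = norm ((2 * \<eta> m) *\<^sub>R e)"
      by (rule arg_cong[of _ _ norm]) (simp add: scaleR_left.add algebra_simps flip: scaleR_2)
    then have "dist (z s + \<eta> m *\<^sub>R e) (z s + (- \<eta> m) *\<^sub>R e) < \<theta>"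
      using m(2) \<eta>(1)[of m] by (simp add: dist_norm)
    then show ?thesis
      using \<theta>(2)[OF inK[OF that, of "- \<eta> m"] inK[OF that, of "\<eta> m"]] \<eta>[of m]
      by (simp add: \<Phi>_def dist_real_def)
  qed
  have der: "((\<lambda>s. P (z s + h *\<^sub>R e)) has_real_derivative G h s) (at s)"
    if "s \<in> {a..b}" "h \<noteq> 0" "\<bar>h\<bar> \<le> \<delta>" for h s
  proof -
    have mem: "z s + h *\<^sub>R e \<in> U - range z"
      by (intro DiffI off[OF that(2)] subsetD[OF \<rho>(2) inK[OF that(1,3)]])
    have eq: "z s + h *\<^sub>R e = (d + k * s + h * fst e, s + h * snd e)"
      by (simp add: z_def prod_eq_iff)
    \<comment> \<open>The shifted point sits at height \<open>s + h * snd e\<close>; the next step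
      reparametrizes the parallel by \<open>s\<close> itself.\<close>
    have "((\<lambda>\<sigma>. P (d + k * s + h * fst e + k * (\<sigma> - (s + h * snd e)), \<sigma>))
        has_real_derivative G h s) (at (s + h * snd e))"
      unfolding G_def eq by (rule deriv[OF mem[unfolded eq]])
    then have "((\<lambda>\<sigma>. P (d + k * s + h * fst e + k * (\<sigma> + h * snd e - (s + h * snd e)), \<sigma> + h * snd e))
        has_real_derivative G h s) (at s)"
      by (simp add: DERIV_shift)
    moreover have "P (d + k * s + h * fst e + k * (\<sigma> + h * snd e - (s + h * snd e)), \<sigma> + h * snd e)
        = P (z \<sigma> + h *\<^sub>R e)" for \<sigma>
      by (rule arg_cong[of _ _ P]) (simp add: z_def prod_eq_iff algebra_simps)
    ultimately show ?thesis by simp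
  qed
  have "(\<Phi> has_real_derivative J m s) (at s)" if "u \<le> s" "s \<le> v" for s
    unfolding \<Phi>_def J_def using that uv(3) \<eta>[of m] by (intro DERIV_diff der) auto
  then obtain \<xi> where \<xi>: "u < \<xi>" "\<xi> < v" "\<Phi> v - \<Phi> u = (v - u) * J m \<xi>"
    using MVT2[OF uv(1), of \<Phi> "J m"] by blast
  have "\<kappa> \<le> (v - u) * (\<tau> * J m \<xi>)"
  proof -
    have "\<xi> \<in> A \<tau> n" using An \<xi>(1,2) by auto
    then have "1 / real (Suc n) \<le> \<tau> * J m \<xi>" using m(1) unfolding A_def by blast
    then show ?thesis using uv(1) mult_left_mono[of "1 / real (Suc n)" "\<tau> * J m \<xi>" "v - u"]
      by (simp add: \<kappa>_def)
  qed
  also have "\<dots> = \<tau> * (\<Phi> v - \<Phi> u)" using \<xi>(3) by simp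
  also have "\<dots> \<le> \<bar>\<tau> * (\<Phi> v - \<Phi> u)\<bar>" by simp
  also have "\<dots> \<le> \<bar>\<Phi> v\<bar> + \<bar>\<Phi> u\<bar>" using \<tau> by (simp add: abs_mult)
  also have "\<dots> < \<kappa>" using small[of u] small[of v] uv by auto
  finally show False by simp
qed

text \<open>Positivity of \<open>s\<close> matters: at level 0 the derivative in the half-plane is
  one-sided, the one on the line two-sided.\<close>

lemma has_specular_derivative_vertical_slice:
  assumes "has_specular_derivative half_plane v e_t (y, s) d" "s > 0"
  shows "has_specular_derivative UNIV (\<lambda>\<sigma>. v (y, \<sigma>)) (1::real) s d"
  using assms
  by (simp add: has_specular_derivative_def has_right_limit_def has_left_limit_def
      right_side_interior left_side_interior interior_half_plane)

lemma has_specular_derivative_horizontal_slice: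
  assumes "has_specular_derivative half_plane v e_x (y, s) d" "s \<ge> 0"
  shows "has_specular_derivative UNIV (\<lambda>\<eta>. v (\<eta>, s)) (1::real) y d"
  using assms
  by (simp add: has_specular_derivative_def has_right_limit_def has_left_limit_def
      half_plane_sides right_side_interior left_side_interior)

lemma open_upper_half_plane: "open (UNIV \<times> {0<..} :: (real \<times> real) set)"
  by (intro open_Times) auto

lemma isCont_upper_half_plane:
  assumes "continuous_on half_plane v" "s > 0"
  shows "isCont v (y, s)"
  using continuous_on_interior[OF assms(1), of "(y, s)"] assms(2) by (simp add: interior_half_plane)

lemma continuous_on_vertical_slice:
  assumes "continuous_on half_plane v" "S \<subseteq> {0..}"
  shows "continuous_on S (\<lambda>\<sigma>. v (y, \<sigma>))"
  by (rule continuous_on_compose2[OF assms(1)]) (use assms(2) in \<open>auto intro!: continuous_intros\<close>)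

lemma continuous_on_horizontal_slice:
  assumes "continuous_on half_plane v" "0 \<le> s"
  shows "continuous_on S (\<lambda>\<eta>. v (\<eta>, s))"
  by (rule continuous_on_compose2[OF assms(1)]) (use assms(2) in \<open>auto intro!: continuous_intros\<close>)

lemma continuous_specular_x_derivative_classical:
  assumes "continuous_on half_plane v" "continuous_on half_plane w" "s > 0"
    and "\<And>\<eta>. has_specular_derivative half_plane v e_x (\<eta>, s) (w (\<eta>, s))"
  shows "((\<lambda>\<eta>. v (\<eta>, s)) has_real_derivative w (y, s)) (at y)"
proof (rule specular_derivative_classical[where a = "y - 1" and b = "y + 1"])
  show "continuous_on {y - 1..y + 1} (\<lambda>\<eta>. v (\<eta>, s))"
    using assms(1,3) by (intro continuous_on_horizontal_slice) auto
  show "isCont (\<lambda>\<eta>. w (\<eta>, s)) y"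
    using isCont_upper_half_plane[OF assms(2,3)]
    by (intro continuous_at_compose[of _ "\<lambda>\<eta>. (\<eta>, s)" w, unfolded o_def] continuous_intros) auto
  show "has_specular_derivative UNIV (\<lambda>\<eta>. v (\<eta>, s)) 1 \<eta> (w (\<eta>, s))" for \<eta>
    using assms(3) by (intro has_specular_derivative_horizontal_slice assms(4)) simp
qed simp

text \<open>With countably many components, uncountably many levels force one component to reach two
  positive levels. Its projection contains the interval between them, and its line, not being
  horizontal, is parametrized by height; so the graph contains a full segment.\<close>

lemma singular_graph_uncountable_levels:
  assumes G: "singular_hyperplane_graph half_plane p G" and unc: "uncountable (snd ` G)"
  obtains k d s1 s2 where "0 < s1" "s1 < s2" "\<And>s. s \<in> {s1..s2} \<Longrightarrow> (d + k * s, s) \<in> G"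
proof -
  from G obtain X c b where c: "c \<noteq> 0" "G = {x \<in> X. c \<bullet> x = b}" and X: "X \<subseteq> half_plane"
    and comps: "countable (components G)"
    unfolding singular_hyperplane_graph_def by blast
  obtain c1 c2 where c12: "c = (c1, c2)" by (cases c)
  have line: "c1 * y + c2 * s = b" if "(y, s) \<in> G" for y s using that c(2) by (simp add: c12)
  have "snd ` G = (\<Union>C\<in>components G. snd ` C)" by (metis Union_components image_Union)
  then have "\<not> (\<forall>C\<in>components G. countable (snd ` C))" using unc comps by auto
  then obtain C where C: "C \<in> components G" "uncountable (snd ` C)" by blast
  \<comment> \<open>Level 0 is discarded so that the segment lies in the open half-plane.\<close>
  have "uncountable (snd ` C - {0})" by (rule uncountable_minus_countable[OF C(2)]) simp
  then have inf: "infinite (snd ` C - {0})" using countable_finite by blast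
  then obtain a where a: "a \<in> snd ` C - {0}" by (metis ex_in_conv finite.emptyI)
  from inf have "infinite (snd ` C - {0} - {a})" by simp
  then obtain a' where a': "a' \<in> snd ` C - {0} - {a}" by (metis ex_in_conv finite.emptyI)
  have "min a a' < max a a'" "min a a' \<in> snd ` C - {0}" "max a a' \<in> snd ` C - {0}"
    using a a' by (auto simp: min_def max_def)
  then obtain s1 s2 where s12: "s1 \<in> snd ` C - {0}" "s2 \<in> snd ` C - {0}" "s1 < s2" by blast
  have CG: "C \<subseteq> G" using C(1) by (rule in_components_subset)
  have "0 < s1" using s12(1) CG X c(2) by force
  have "connected (snd ` C)"
    using in_components_connected[OF C(1)] by (intro connected_continuous_image continuous_intros)
  then have sub: "{s1..s2} \<subseteq> snd ` C" using s12 by (intro connected_contains_Icc) auto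
  have "c1 \<noteq> 0"
  proof
    assume c1: "c1 = 0"
    obtain y1 y2 where "(y1, s1) \<in> C" "(y2, s2) \<in> C" using s12(1,2) by auto
    then have "(y1, s1) \<in> G" "(y2, s2) \<in> G" using CG by auto
    from this[THEN line] have "c2 * s1 = c2 * s2" using c1 by simp
    then have "c2 = 0" using s12(3) by simp
    then show False using c1 c(1) by (simp add: c12 zero_prod_def)
  qed
  have "(b / c1 + (- c2 / c1) * s, s) \<in> G" if "s \<in> {s1..s2}" for s
  proof -
    have "s \<in> snd ` C" using that sub by blast
    then obtain y where y: "(y, s) \<in> G" using CG by auto
    have "y = b / c1 + (- c2 / c1) * s" using line[OF y] \<open>c1 \<noteq> 0\<close> by (auto simp: field_simps)
    then show ?thesis using y by simp
  qed
  then show thesis using that \<open>0 < s1\<close> s12(3) by blast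
qed

text \<open>A graph need not be closed, so it is enlarged to its line, which meets the given line in
  at most one point; if the two lines coincide, the empty set serves. Finiteness later allows a
  point of a segment to be chosen away from all other lines.\<close>

lemma singular_graph_in_closed_set:
  assumes G: "singular_hyperplane_graph half_plane p G"
  shows "\<exists>L. closed L \<and> G \<subseteq> L \<union> range (\<lambda>s. (d + k * s, s)) \<and> finite {s. (d + k * s, s) \<in> L}"
proof -
  from G obtain X c b where c: "c \<noteq> 0" "G = {x \<in> X. c \<bullet> x = b}"
    unfolding singular_hyperplane_graph_def by blast
  obtain c1 c2 where c12: "c = (c1, c2)" by (cases c)
  have z: "c \<bullet> (d + k * s, s) = c1 * d + (c1 * k + c2) * s" for s by (simp add: c12 algebra_simps)
  show ?thesis
  proof (cases "c1 * k + c2 = 0 \<and> c1 * d = b")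
    case True
    then have "c1 \<noteq> 0" using c(1) by (auto simp: c12 zero_prod_def)
    have "x \<in> range (\<lambda>s. (d + k * s, s))" if "x \<in> G" for x
    proof -
      obtain y s where x: "x = (y, s)" by (cases x)
      have "c1 * y + c2 * s = c1 * d" using that c(2) True by (simp add: c12 x)
      moreover have "c2 = - (c1 * k)" using True by simp
      ultimately have "c1 * y = c1 * (d + k * s)" by (simp add: algebra_simps)
      then have "y = d + k * s" using \<open>c1 \<noteq> 0\<close> by simp
      then show ?thesis unfolding x by blast
    qed
    then show ?thesis by (intro exI[of _ "{}"]) auto
  next
    case False
    have "{s. c \<bullet> (d + k * s, s) = b} \<subseteq> {(b - c1 * d) / (c1 * k + c2)}"
    proof
      fix s assume "s \<in> {s. c \<bullet> (d + k * s, s) = b}"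
      then have eq: "c1 * d + (c1 * k + c2) * s = b" unfolding z by simp
      then have "c1 * k + c2 \<noteq> 0" using False by auto
      moreover have "s * (c1 * k + c2) = b - c1 * d"
        using eq by (simp add: mult.commute flip: eq)
      ultimately show "s \<in> {(b - c1 * d) / (c1 * k + c2)}" using nonzero_eq_divide_eq by blast
    qed
    then have "finite {s. c \<bullet> (d + k * s, s) = b}" by (rule finite_subset) simp
    moreover have "G \<subseteq> {x. c \<bullet> x = b}" using c(2) by blast
    ultimately show ?thesis using closed_hyperplane[of c b]
      by (intro exI[of _ "{x. c \<bullet> x = b}"]) (simp only: mem_Collect_eq le_supI1)
  qed
qed

text \<open>Uncountably many levels would put a non-horizontal segment into \<open>G\<close>. Its
  jump is refuted in two ways, according to whether the jump direction runs along the segment or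
  across it.\<close>

lemma countable_singular_levels:
  assumes P: "continuous_on half_plane P" and w: "continuous_on half_plane w"
    and dx: "\<And>y s. 0 < s \<Longrightarrow> has_specular_derivative half_plane P e_x (y, s) (w (y, s))"
    and dt: "\<And>y s. 0 < s \<Longrightarrow> has_specular_derivative half_plane P e_t (y, s) (p (y, s))"
    and \<G>: "finite \<G>" "\<And>G. G \<in> \<G> \<Longrightarrow> singular_hyperplane_graph half_plane p G"
    and p: "continuous_on (half_plane - \<Union>\<G>) p"
    and G: "G \<in> \<G>"
  shows "countable (snd ` G)"
proof (rule ccontr)
  assume unc: "uncountable (snd ` G)"
  obtain k d s1 s2 where s12: "0 < s1" "s1 < s2"
    and inG: "\<And>s. s \<in> {s1..s2} \<Longrightarrow> (d + k * s, s) \<in> G"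
    by (rule singular_graph_uncountable_levels[OF \<G>(2)[OF G] unc]) blast
  define z where "z = (\<lambda>s. (d + k * s, s))"
  obtain e where e: "e \<in> Basis"
    and jumpG: "\<And>x. x \<in> G \<Longrightarrow> \<exists>l r. has_left_limit half_plane p e x l \<and> has_right_limit half_plane p e x r \<and> l \<noteq> r"
    using \<G>(2)[OF G] unfolding singular_hyperplane_graph_def by blast
  have jump: "\<exists>l r. ((\<lambda>h. p (z s + h *\<^sub>R e)) \<longlongrightarrow> l) (at_left 0) \<and>
      ((\<lambda>h. p (z s + h *\<^sub>R e)) \<longlongrightarrow> r) (at_right 0) \<and> l \<noteq> r" if "s \<in> {s1..s2}" for s
  proof -
    have "z s \<in> interior half_plane" using that s12 by (simp add: interior_half_plane z_def)
    then show ?thesis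
      using jumpG[OF inG[OF that]]
      by (simp add: has_left_limit_def has_right_limit_def z_def right_side_interior left_side_interior)
  qed
  show False
  proof (cases "fst e = k * snd e")
    case True
    \<comment> \<open>A coordinate direction along the segment means a vertical segment, and then a
      single function of \<open>\<sigma>\<close> would jump at every point of an interval.\<close>
    then have et: "e = e_t" "k = 0" using e unfolding set_basis_half_plane(2)[symmetric] by auto
    have "{s1..s2} \<subseteq> {x. \<exists>l r. ((\<lambda>\<sigma>. p (d, \<sigma>)) \<longlongrightarrow> l) (at_left x) \<and> ((\<lambda>\<sigma>. p (d, \<sigma>)) \<longlongrightarrow> r) (at_right x) \<and> l \<noteq> r}"
    proof
      fix s assume "s \<in> {s1..s2}"
      from jump[OF this] show "s \<in> {x. \<exists>l r. ((\<lambda>\<sigma>. p (d, \<sigma>)) \<longlongrightarrow> l) (at_left x) \<and>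
          ((\<lambda>\<sigma>. p (d, \<sigma>)) \<longlongrightarrow> r) (at_right x) \<and> l \<noteq> r}"
        by (simp add: z_def et filterlim_shift_left[of _ _ s] filterlim_shift_right[of _ _ s])
    qed
    then have "countable {s1..s2}" using countable_left_neq_right_limit countable_subset by blast
    then show False using s12 uncountable_closed_interval by blast
  next
    case False
    obtain L where L: "\<And>G'. G' \<in> \<G> \<Longrightarrow> closed (L G') \<and> G' \<subseteq> L G' \<union> range z \<and> finite {s. z s \<in> L G'}"
    proof -
      have "\<forall>G'\<in>\<G>. \<exists>L. closed L \<and> G' \<subseteq> L \<union> range z \<and> finite {s. z s \<in> L}"
        unfolding z_def by (intro ballI singular_graph_in_closed_set[OF \<G>(2)])
      from bchoice[OF this] show thesis using that by blast
    qed
    define Z where "Z = \<Union>(L ` \<G>)"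
    have "closed Z" using \<G>(1) L by (auto simp: Z_def intro!: closed_Union)
    have "{s. z s \<in> Z} = (\<Union>G'\<in>\<G>. {s. z s \<in> L G'})" by (auto simp: Z_def)
    then have "finite {s. z s \<in> Z}" using \<G>(1) L by simp
    have "infinite {s1<..<s2}" using s12 by simp
    obtain s0 where s0: "s0 \<in> {s1<..<s2}" "z s0 \<notin> Z"
    proof -
      have "infinite ({s1<..<s2} - {s. z s \<in> Z})"
        using Diff_infinite_finite[OF \<open>finite {s. z s \<in> Z}\<close> \<open>infinite {s1<..<s2}\<close>] .
      then obtain s0 where "s0 \<in> {s1<..<s2} - {s. z s \<in> Z}" by (metis ex_in_conv finite.emptyI)
      then show thesis using that by blast
    qed
    \<comment> \<open>Inside \<open>U\<close> all graphs lie on the line \<open>range z\<close>, so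
      \<open>p\<close> is continuous on \<open>U\<close> off that line.\<close>
    define U where "U = - Z \<inter> UNIV \<times> {0<..}"
    have U: "open U" "U \<subseteq> half_plane" "z s0 \<in> U"
      using \<open>closed Z\<close> open_upper_half_plane s0 s12 by (auto simp: U_def z_def)
    have "range z = {x. fst x = d + k * snd x}" by (auto simp: z_def)
    then have "closed (range z)" by (simp add: closed_Collect_eq continuous_intros)
    then have W: "open (U - range z)" using U(1) by (rule open_Diff[rotated])
    have "U - range z \<subseteq> half_plane - \<Union>\<G>"
      using L U(2) by (fastforce simp: U_def Z_def)
    then have pW: "continuous_on (U - range z) p" using continuous_on_subset[OF p] by blast
    \<comment> \<open>The derivative of \<open>P\<close> in direction \<open>(k, 1)\<close> is
      \<open>p + k * w\<close>, and the continuous term \<open>k * w\<close> keeps the two limits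
      distinct.\<close>
    show False
    proof (rule no_transverse_jump[OF z_def, where P = P and g = "\<lambda>x. p x + k * w x" and U = U
          and ?s0.0 = s0 and ?s1.0 = s1 and ?s2.0 = s2 and e = e])
      show "continuous_on U P" using continuous_on_subset[OF P U(2)] .
      show "continuous_on (U - range z) (\<lambda>x. p x + k * w x)"
        by (intro continuous_intros pW continuous_on_subset[OF w]) (use U(2) in blast)
      show "((\<lambda>\<sigma>. P (y + k * (\<sigma> - s), \<sigma>)) has_real_derivative p (y, s) + k * w (y, s)) (at s)"
        if ys: "(y, s) \<in> U - range z" for y s
      proof (rule has_real_derivative_slanted[OF _ open_upper_half_plane])
        have s: "s > 0" using ys by (auto simp: U_def)
        then show "(y, s) \<in> UNIV \<times> {0<..}" by simp
        show "isCont w (y, s)" using isCont_upper_half_plane[OF w s] .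
        show "((\<lambda>\<eta>. P (\<eta>, \<sigma>)) has_real_derivative w (\<eta>, \<sigma>)) (at \<eta>)" if "(\<eta>, \<sigma>) \<in> UNIV \<times> {0<..}" for \<eta> \<sigma>
          using that by (intro continuous_specular_x_derivative_classical P w dx) auto
        show "((\<lambda>\<sigma>. P (y, \<sigma>)) has_real_derivative p (y, s)) (at s)"
        proof (rule specular_derivative_classical[where a = "s / 2" and b = "s + 1"])
          show "continuous_on {s/2..s + 1} (\<lambda>\<sigma>. P (y, \<sigma>))"
            using s by (intro continuous_on_vertical_slice P) auto
          \<comment> \<open>Continuity of \<open>p\<close> off the graphs upgrades the specular time
            derivative to a classical one.\<close>
          have "isCont p (y, s)" using pW ys W by (simp add: continuous_on_eq_continuous_at)
          then show "isCont (\<lambda>\<sigma>. p (y, \<sigma>)) s"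
            by (intro continuous_at_compose[of _ "\<lambda>\<sigma>. (y, \<sigma>)" p, unfolded o_def] continuous_intros) auto
          show "has_specular_derivative UNIV (\<lambda>\<sigma>. P (y, \<sigma>)) 1 \<sigma> (p (y, \<sigma>))" if "\<sigma> \<in> {s/2<..<s + 1}" for \<sigma>
            using that s by (intro has_specular_derivative_vertical_slice dt) auto
        qed (use s in auto)
      qed
      show "\<exists>l r. ((\<lambda>h. p (z s + h *\<^sub>R e) + k * w (z s + h *\<^sub>R e)) \<longlongrightarrow> l) (at_left 0) \<and>
          ((\<lambda>h. p (z s + h *\<^sub>R e) + k * w (z s + h *\<^sub>R e)) \<longlongrightarrow> r) (at_right 0) \<and> l \<noteq> r"
        if s: "s \<in> {s1..s2}" for s
      proof -
        have "isCont w (z s)" using isCont_upper_half_plane[OF w] s s12 by (simp add: z_def)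
        then have "isCont (\<lambda>h. w (z s + h *\<^sub>R e)) 0"
          by (intro continuous_at_compose[of _ "\<lambda>h. z s + h *\<^sub>R e" w, unfolded o_def] continuous_intros) auto
        then have "((\<lambda>h. w (z s + h *\<^sub>R e)) \<longlongrightarrow> w (z s)) (at_left 0)"
          "((\<lambda>h. w (z s + h *\<^sub>R e)) \<longlongrightarrow> w (z s)) (at_right 0)"
          by (simp_all add: isCont_def filterlim_at_split)
        note lim = tendsto_mult[OF tendsto_const[of k] this(1)] tendsto_mult[OF tendsto_const[of k] this(2)]
        from jump[OF s] obtain l r where "((\<lambda>h. p (z s + h *\<^sub>R e)) \<longlongrightarrow> l) (at_left 0)"
          "((\<lambda>h. p (z s + h *\<^sub>R e)) \<longlongrightarrow> r) (at_right 0)" "l \<noteq> r" by blast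
        then show ?thesis
          by (intro exI[of _ "l + k * w (z s)"] exI[of _ "r + k * w (z s)"] conjI tendsto_add lim) auto
      qed
    qed (use U s0 False in auto)
  qed
qed

subsection \<open>The characteristic triangle\<close>

text \<open>The second point ranges over all of \<open>S\<close>, which is more than uniform
  continuity on \<open>K\<close>. Here \<open>K\<close> will be a row and \<open>S\<close> the
  complement of the graphs, which need not be a neighbourhood of that row. The radius is a Lebesgue
  number for the balls of local continuity.\<close>

lemma continuous_on_uniform_near_compact:
  fixes f :: "'a::metric_space \<Rightarrow> 'b::metric_space"
  assumes f: "continuous_on S f" and K: "compact K" "K \<subseteq> S" and "0 < e"
  obtains d where "0 < d" "\<And>z z'. z \<in> K \<Longrightarrow> z' \<in> S \<Longrightarrow> dist z' z < d \<Longrightarrow> dist (f z') (f z) < e"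
proof -
  have "\<forall>z\<in>K. \<exists>r>0. \<forall>z'\<in>S. dist z' z < r \<longrightarrow> dist (f z') (f z) < e / 2"
    using f K(2) half_gt_zero[OF \<open>0 < e\<close>] unfolding continuous_on_iff by blast
  from bchoice[OF this] obtain r where r: "\<And>z. z \<in> K \<Longrightarrow> r z > 0"
    "\<And>z z'. z \<in> K \<Longrightarrow> z' \<in> S \<Longrightarrow> dist z' z < r z \<Longrightarrow> dist (f z') (f z) < e / 2" by blast
  have "K \<subseteq> \<Union>((\<lambda>z. ball z (r z)) ` K)" using r(1) by force
  then obtain d where d: "0 < d" "\<And>x. x \<in> K \<Longrightarrow> \<exists>G\<in>(\<lambda>z. ball z (r z)) ` K. ball x d \<subseteq> G"
    using Heine_Borel_lemma[OF K(1), of "(\<lambda>z. ball z (r z)) ` K"] by blast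
  show thesis
  proof (rule that[OF d(1)])
    fix z z' assume z: "z \<in> K" "z' \<in> S" "dist z' z < d"
    obtain c where c: "c \<in> K" "ball z d \<subseteq> ball c (r c)" using d(2)[OF z(1)] by blast
    have "z \<in> ball z d" "z' \<in> ball z d" using z(3) d(1) by (auto simp: dist_commute)
    then have "z \<in> ball c (r c)" "z' \<in> ball c (r c)" using c(2) by blast+
    then have "dist z c < r c" "dist z' c < r c" by (simp_all add: dist_commute)
    moreover have "z \<in> S" using z(1) K(2) by blast
    ultimately have "dist (f z) (f c) < e / 2" "dist (f z') (f c) < e / 2"
      using r(2)[OF c(1)] z(2) by blast+
    then show "dist (f z') (f z) < e" by (metis dist_commute dist_triangle_half_r)
  qed
qed

text \<open>The row at level \<open>s\<close> is compact and misses \<open>B\<close>, so near it,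
  off \<open>B\<close>, the values of \<open>p\<close> are uniformly close to those on the row. On a
  vertical segment \<open>B\<close> occupies countably many levels only, and the mean value estimate
  controls the difference quotients uniformly in \<open>y\<close>.\<close>

lemma integral_level_derivative:
  assumes P: "continuous_on half_plane P"
    and dt: "\<And>y s. 0 < s \<Longrightarrow> has_specular_derivative half_plane P e_t (y, s) (p (y, s))"
    and p: "continuous_on (half_plane - B) p" and B: "countable (snd ` B)"
    and s: "0 < s" "s \<notin> snd ` B" and "a \<le> b"
  shows "((\<lambda>\<sigma>. integral {a..b} (\<lambda>y. P (y, \<sigma>))) has_real_derivative
    integral {a..b} (\<lambda>y. p (y, s))) (at s)"
  unfolding has_field_derivative_def has_derivative_at_alt
proof (intro conjI allI impI)
  show "bounded_linear ((*) (integral {a..b} (\<lambda>y. p (y, s))))" by (rule bounded_linear_mult_right)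
  fix e :: real assume "0 < e"
  \<comment> \<open>The errors of the quotients are integrated over length \<open>b - a\<close>; the
    added 1 covers \<open>a = b\<close>.\<close>
  define \<epsilon> where "\<epsilon> = e / (b - a + 1)"
  have \<epsilon>: "0 < \<epsilon>" "\<epsilon> * (b - a) \<le> e"
    using \<open>0 < e\<close> \<open>a \<le> b\<close> by (auto simp: \<epsilon>_def field_simps)
  have offB: "(y, \<sigma>) \<in> half_plane - B" if "0 < \<sigma>" "\<sigma> \<notin> snd ` B" for y \<sigma>
    using that by force
  have row: "continuous_on {a..b} (\<lambda>y. p (y, s))"
    using offB[OF s]
    by (intro continuous_on_compose2[OF p, of _ "\<lambda>y. (y, s)"] continuous_intros) auto
  have "compact ({a..b} \<times> {s})" "{a..b} \<times> {s} \<subseteq> half_plane - B"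
    using offB[OF s] by (auto intro: compact_Times)
  from continuous_on_uniform_near_compact[OF p this \<epsilon>(1)] obtain d where d: "0 < d"
    "\<And>z z'. z \<in> {a..b} \<times> {s} \<Longrightarrow> z' \<in> half_plane - B \<Longrightarrow> dist z' z < d \<Longrightarrow> dist (p z') (p z) < \<epsilon>"
    by blast
  \<comment> \<open>The bound by \<open>s\<close> keeps all levels positive, where \<open>dt\<close>
    applies.\<close>
  define \<delta> where "\<delta> = min d s"
  have est: "\<bar>P (y, \<tau>) - P (y, \<sigma>) - p (y, s) * (\<tau> - \<sigma>)\<bar> \<le> \<epsilon> * (\<tau> - \<sigma>)"
    if y: "y \<in> {a..b}" and "\<sigma> \<le> \<tau>" "s - \<delta> < \<sigma>" "\<tau> < s + \<delta>" for y \<sigma> \<tau>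
  proof (rule specular_mean_value_estimate[OF \<open>\<sigma> \<le> \<tau>\<close>])
    have pos: "0 < \<sigma>" using that by (simp add: \<delta>_def)
    then show "continuous_on {\<sigma>..\<tau>} (\<lambda>\<sigma>. P (y, \<sigma>))" by (intro continuous_on_vertical_slice P) auto
    show "has_specular_derivative UNIV (\<lambda>\<sigma>. P (y, \<sigma>)) 1 \<rho> (p (y, \<rho>))" if "\<rho> \<in> {\<sigma><..<\<tau>}" for \<rho>
      using that pos by (intro has_specular_derivative_vertical_slice dt) auto
    show "countable (snd ` B)" by (rule B)
    show "\<bar>p (y, \<rho>) - p (y, s)\<bar> \<le> \<epsilon>" if \<rho>: "\<rho> \<in> {\<sigma><..<\<tau>} - snd ` B" for \<rho>
    proof -
      have "\<bar>\<rho> - s\<bar> < d" using \<rho> \<open>s - \<delta> < \<sigma>\<close> \<open>\<tau> < s + \<delta>\<close> by (auto simp: \<delta>_def)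
      then have "dist (y, \<rho>) (y, s) < d" by (simp add: dist_Pair_Pair dist_real_def)
      moreover have "(y, \<rho>) \<in> half_plane - B" using \<rho> pos by (intro offB) auto
      ultimately have "dist (p (y, \<rho>)) (p (y, s)) < \<epsilon>" using y by (intro d(2)) auto
      then show ?thesis by (simp add: dist_real_def)
    qed
  qed (use \<epsilon> in simp)
  show "\<exists>d>0. \<forall>\<sigma>. norm (\<sigma> - s) < d \<longrightarrow>
      norm (integral {a..b} (\<lambda>y. P (y, \<sigma>)) - integral {a..b} (\<lambda>y. P (y, s)) -
        integral {a..b} (\<lambda>y. p (y, s)) * (\<sigma> - s)) \<le> e * norm (\<sigma> - s)"
  proof (intro exI[of _ \<delta>] conjI allI impI)
    show "0 < \<delta>" using d(1) s(1) by (simp add: \<delta>_def)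
    fix \<sigma> assume "norm (\<sigma> - s) < \<delta>"
    then have \<sigma>: "s - \<delta> < \<sigma>" "\<sigma> < s + \<delta>" "0 < \<sigma>" by (auto simp: \<delta>_def)
    let ?r = "\<lambda>y. P (y, \<sigma>) - P (y, s) - p (y, s) * (\<sigma> - s)"
    have bound: "\<bar>?r y\<bar> \<le> \<epsilon> * \<bar>\<sigma> - s\<bar>" if "y \<in> {a..b}" for y
    proof (cases "s \<le> \<sigma>")
      case True
      then show ?thesis using est[OF that True] \<sigma> \<open>0 < \<delta>\<close> by simp
    next
      case False
      have "?r y = - (P (y, s) - P (y, \<sigma>) - p (y, s) * (s - \<sigma>))" by (simp add: algebra_simps)
      then have "\<bar>?r y\<bar> = \<bar>P (y, s) - P (y, \<sigma>) - p (y, s) * (s - \<sigma>)\<bar>" by (simp only: abs_minus_cancel)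
      then show ?thesis using est[OF that, of \<sigma> s] \<sigma> \<open>0 < \<delta>\<close> False by simp
    qed
    have int: "(\<lambda>y. P (y, \<sigma>)) integrable_on {a..b}" "(\<lambda>y. P (y, s)) integrable_on {a..b}"
      "(\<lambda>y. p (y, s)) integrable_on {a..b}"
      using \<sigma>(3) s(1) by (auto intro!: integrable_continuous_interval continuous_on_horizontal_slice P row)
    have "((\<lambda>y. ?r y) has_integral (integral {a..b} (\<lambda>y. P (y, \<sigma>)) - integral {a..b} (\<lambda>y. P (y, s)) -
        integral {a..b} (\<lambda>y. p (y, s)) * (\<sigma> - s))) (cbox a b)"
      unfolding box_real by (intro has_integral_diff has_integral_mult_left integrable_integral int)
    then have "norm (integral {a..b} (\<lambda>y. P (y, \<sigma>)) - integral {a..b} (\<lambda>y. P (y, s)) -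
        integral {a..b} (\<lambda>y. p (y, s)) * (\<sigma> - s)) \<le> \<epsilon> * \<bar>\<sigma> - s\<bar> * measure lborel (cbox a b)"
      using bound \<epsilon>(1) by (intro has_integral_bound) auto
    also have "\<dots> = \<epsilon> * (b - a) * \<bar>\<sigma> - s\<bar>" using \<open>a \<le> b\<close> by simp
    also have "\<dots> \<le> e * norm (\<sigma> - s)" using \<epsilon>(2) by (simp add: mult_right_mono)
    finally show "norm (integral {a..b} (\<lambda>y. P (y, \<sigma>)) - integral {a..b} (\<lambda>y. P (y, s)) -
        integral {a..b} (\<lambda>y. p (y, s)) * (\<sigma> - s)) \<le> e * norm (\<sigma> - s)" .
  qed
qed

text \<open>At a fixed level the integral is Lipschitz in its endpoint, uniformly in the level, by a
  bound of \<open>P\<close> on a rectangle. With the endpoint frozen at \<open>\<zeta> s\<close> it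
  is continuous in the level.\<close>

lemma continuous_on_integral_moving_endpoint:
  fixes P :: "real \<times> real \<Rightarrow> real"
  assumes P: "continuous_on half_plane P" and \<zeta>: "continuous_on {0..t} \<zeta>"
    and range: "\<And>\<sigma>. \<sigma> \<in> {0..t} \<Longrightarrow> \<zeta> \<sigma> \<in> {a..b}"
  shows "continuous_on {0..t} (\<lambda>\<sigma>. integral {a..\<zeta> \<sigma>} (\<lambda>y. P (y, \<sigma>)))"
  unfolding continuous_on_def
proof
  fix s assume s: "s \<in> {0..t}"
  have "bounded (P ` ({a..b} \<times> {0..t}))"
    by (intro compact_imp_bounded compact_continuous_image continuous_on_subset[OF P] compact_Times) auto
  then obtain M where M: "\<And>y \<sigma>. y \<in> {a..b} \<Longrightarrow> \<sigma> \<in> {0..t} \<Longrightarrow> \<bar>P (y, \<sigma>)\<bar> \<le> M"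
    unfolding bounded_iff by (metis (no_types, lifting) SigmaI imageI real_norm_def)
  have "0 \<le> M" using M[OF range[OF s] s] by linarith
  have int: "(\<lambda>y. P (y, \<sigma>)) integrable_on {c..d}" if "\<sigma> \<in> {0..t}" for \<sigma> c d
    using that by (intro integrable_continuous_interval continuous_on_horizontal_slice P) auto
  have lip: "\<bar>integral {a..d} (\<lambda>y. P (y, \<sigma>)) - integral {a..c} (\<lambda>y. P (y, \<sigma>))\<bar> \<le> M * \<bar>d - c\<bar>"
    if "\<sigma> \<in> {0..t}" "c \<in> {a..b}" "d \<in> {a..b}" "c \<le> d" for \<sigma> c d
  proof -
    have "integral {a..c} (\<lambda>y. P (y, \<sigma>)) + integral {c..d} (\<lambda>y. P (y, \<sigma>)) = integral {a..d} (\<lambda>y. P (y, \<sigma>))"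
      using that by (intro Henstock_Kurzweil_Integration.integral_combine int) auto
    moreover have "norm (integral {c..d} (\<lambda>y. P (y, \<sigma>))) \<le> M * (d - c)"
      using that M by (intro integral_bound continuous_on_horizontal_slice P) auto
    ultimately show ?thesis using that by simp
  qed
  have lip': "norm (integral {a..\<zeta> \<sigma>} (\<lambda>y. P (y, \<sigma>)) - integral {a..\<zeta> s} (\<lambda>y. P (y, \<sigma>))) \<le> M * \<bar>\<zeta> \<sigma> - \<zeta> s\<bar>"
    if "\<sigma> \<in> {0..t}" for \<sigma>
    using lip[OF that range[OF s] range[OF that]] lip[OF that range[OF that] range[OF s]]
    by (cases "\<zeta> s \<le> \<zeta> \<sigma>") (auto simp: abs_minus_commute)
  have "continuous_on {0..t} (\<lambda>\<sigma>. integral (cbox a (\<zeta> s)) (\<lambda>y. P (y, \<sigma>)))"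
    by (intro integral_continuous_on_param)
      (auto simp: split_def intro!: continuous_intros continuous_on_compose2[OF P])
  then have 1: "((\<lambda>\<sigma>. integral {a..\<zeta> s} (\<lambda>y. P (y, \<sigma>))) \<longlongrightarrow> integral {a..\<zeta> s} (\<lambda>y. P (y, s))) (at s within {0..t})"
    using s by (simp add: continuous_on_def)
  have "((\<lambda>\<sigma>. M * \<bar>\<zeta> \<sigma> - \<zeta> s\<bar>) \<longlongrightarrow> M * \<bar>\<zeta> s - \<zeta> s\<bar>) (at s within {0..t})"
    using \<zeta> s unfolding continuous_on_def by (intro tendsto_intros) auto
  then have 2: "((\<lambda>\<sigma>. M * \<bar>\<zeta> \<sigma> - \<zeta> s\<bar>) \<longlongrightarrow> 0) (at s within {0..t})" by simp
  have "\<forall>\<^sub>F \<sigma> in at s within {0..t}.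
      norm (integral {a..\<zeta> \<sigma>} (\<lambda>y. P (y, \<sigma>)) - integral {a..\<zeta> s} (\<lambda>y. P (y, \<sigma>))) \<le> M * \<bar>\<zeta> \<sigma> - \<zeta> s\<bar>"
    unfolding eventually_at_filter by (intro always_eventually allI impI lip')
  then have "((\<lambda>\<sigma>. integral {a..\<zeta> \<sigma>} (\<lambda>y. P (y, \<sigma>)) - integral {a..\<zeta> s} (\<lambda>y. P (y, \<sigma>))) \<longlongrightarrow> 0) (at s within {0..t})"
    using 2 by (rule Lim_null_comparison)
  from tendsto_add[OF this 1]
  show "((\<lambda>\<sigma>. integral {a..\<zeta> \<sigma>} (\<lambda>y. P (y, \<sigma>))) \<longlongrightarrow> integral {a..\<zeta> s} (\<lambda>y. P (y, s))) (at s within {0..t})"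
    by simp
qed

text \<open>
  Along the backward characteristic triangle the function \<open>Z\<close> below has the inner integral of
  \<open>f\<close> as its derivative: the boundary contributions of \<open>u\<^sub>t\<close> cancel and those of \<open>u\<^sub>x\<close> integrate
  the second space derivative.
\<close>

lemma wave_equation_characteristic_triangle:
  fixes u v w p q f :: "real \<times> real \<Rightarrow> real"
  assumes u: "continuous_on half_plane u" and v: "continuous_on half_plane v"
    and w: "continuous_on half_plane w"
    and ut: "\<And>y s. 0 < s \<Longrightarrow> ((\<lambda>\<sigma>. u (y, \<sigma>)) has_real_derivative v (y, s)) (at s)"
    and ux: "\<And>y s. 0 < s \<Longrightarrow> ((\<lambda>\<eta>. u (\<eta>, s)) has_real_derivative w (y, s)) (at y)"
    and dt: "\<And>y s. 0 < s \<Longrightarrow> has_specular_derivative half_plane v e_t (y, s) (p (y, s))"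
    and dx: "\<And>y s. 0 < s \<Longrightarrow> has_specular_derivative half_plane w e_x (y, s) (q (y, s))"
    and p: "continuous_on (half_plane - B) p" and B: "countable (snd ` B)"
    and eq: "\<And>y s. 0 < s \<Longrightarrow> p (y, s) - q (y, s) = f (y, s)"
    and t: "0 \<le> t"
  shows "((\<lambda>s. integral {x - t + s..x + t - s} (\<lambda>y. f (y, s))) has_integral
    (2 * u (x, t) - (u (x + t, 0) + u (x - t, 0)) - integral {x - t..x + t} (\<lambda>y. v (y, 0)))) {0..t}"
proof -
  \<comment> \<open>Any point strictly to the left of the triangle would do: \<open>A\<close> then
    has a two-sided derivative in its endpoint at both ends of every slice.\<close>
  define a where "a = x - t - 1"
  \<comment> \<open>The antiderivative turns an integral with two moving ends into a difference of
    values along the two characteristics, to which differentiation on slanted lines applies.\<close>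
  define A where "A = (\<lambda>(z, s). integral {a..z} (\<lambda>y. v (y, s)))"
  define Z where "Z s = A (x + t - s, s) - A (x - t + s, s) + u (x + t - s, s) + u (x - t + s, s)" for s
  have intv: "(\<lambda>y. v (y, s)) integrable_on {c..d}" if "0 \<le> s" for s c d
    using that by (intro integrable_continuous_interval continuous_on_horizontal_slice v)
  have A_slanted: "((\<lambda>\<sigma>. A (z + k * (\<sigma> - s), \<sigma>)) has_real_derivative
      integral {a..z} (\<lambda>y. p (y, s)) + k * v (z, s)) (at s)"
    if "0 < s" "s \<notin> snd ` B" "a < z" for z s k
  proof (rule has_real_derivative_slanted[where U = "{a<..} \<times> {0<..}"])
    show "open ({a<..} \<times> {0<..} :: (real \<times> real) set)" by (intro open_Times) auto
    show "((\<lambda>\<sigma>. A (z, \<sigma>)) has_real_derivative integral {a..z} (\<lambda>y. p (y, s))) (at s)"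
      unfolding A_def case_prod_conv
      using that by (intro integral_level_derivative[OF v dt p B]) auto
    show "((\<lambda>\<eta>. A (\<eta>, \<sigma>)) has_real_derivative v (\<eta>, \<sigma>)) (at \<eta>)" if "(\<eta>, \<sigma>) \<in> {a<..} \<times> {0<..}" for \<eta> \<sigma>
    proof -
      have "((\<lambda>\<eta>. A (\<eta>, \<sigma>)) has_real_derivative v (\<eta>, \<sigma>)) (at \<eta> within {a..\<eta> + 1})"
        unfolding A_def case_prod_conv
        using that by (intro integral_has_real_derivative continuous_on_horizontal_slice v) auto
      moreover have "\<eta> \<in> interior {a..\<eta> + 1}" using that by (simp add: interior_atLeastAtMost_real)
      ultimately show ?thesis by (simp only: at_within_interior)
    qed
    show "isCont v (z, s)" by (rule isCont_upper_half_plane[OF v that(1)])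
  qed (use that in auto)
  have u_slanted: "((\<lambda>\<sigma>. u (z + k * (\<sigma> - s), \<sigma>)) has_real_derivative v (z, s) + k * w (z, s)) (at s)"
    if "0 < s" for z s k
    using that ut ux isCont_upper_half_plane[OF w that]
    by (intro has_real_derivative_slanted[OF _ open_upper_half_plane]) auto
  have Z_deriv: "(Z has_vector_derivative integral {x - t + s..x + t - s} (\<lambda>y. f (y, s))) (at s)"
    if s: "s \<in> {0<..<t} - snd ` B" for s
  proof -
    define l r where "l = x - t + s" and "r = x + t - s"
    have lr: "l \<le> r" "a < l" "a < r" and s': "0 < s" "s \<notin> snd ` B" using s by (auto simp: l_def r_def a_def)
    have row: "continuous_on S (\<lambda>y. p (y, s))" for S
      using s' by (intro continuous_on_compose2[OF p, of _ "\<lambda>y. (y, s)"] continuous_intros) force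
    then have intp: "(\<lambda>y. p (y, s)) integrable_on {c..d}" for c d
      by (intro integrable_continuous_interval)
    \<comment> \<open>In space no positive level is exceptional: \<open>w\<close> is continuous on
      the row, so its specular derivative integrates to its increment whatever the graphs of
      \<open>q\<close> are.\<close>
    have q: "((\<lambda>y. q (y, s)) has_integral (w (r, s) - w (l, s))) {l..r}"
      using s' by (intro specular_fundamental_theorem_of_calculus[OF lr(1)] continuous_on_horizontal_slice w
          has_specular_derivative_horizontal_slice dx) auto
    have "((\<lambda>y. p (y, s) - q (y, s)) has_integral (integral {l..r} (\<lambda>y. p (y, s)) - (w (r, s) - w (l, s)))) {l..r}"
      by (intro has_integral_diff integrable_integral intp q)
    then have f: "integral {l..r} (\<lambda>y. f (y, s)) = integral {l..r} (\<lambda>y. p (y, s)) - (w (r, s) - w (l, s))"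
      using eq[OF s'(1)] by (simp add: integral_unique)
    have split: "integral {a..l} (\<lambda>y. p (y, s)) + integral {l..r} (\<lambda>y. p (y, s)) = integral {a..r} (\<lambda>y. p (y, s))"
      using lr intp by (intro Henstock_Kurzweil_Integration.integral_combine) auto
    \<comment> \<open>Slope -1 follows the right end of the slice and slope 1 the left end; with
      these signs the four terms in \<open>v\<close> cancel.\<close>
    have "((\<lambda>\<sigma>. A (r + (-1) * (\<sigma> - s), \<sigma>) - A (l + 1 * (\<sigma> - s), \<sigma>) + u (r + (-1) * (\<sigma> - s), \<sigma>) + u (l + 1 * (\<sigma> - s), \<sigma>))
      has_real_derivative
        ((integral {a..r} (\<lambda>y. p (y, s)) + (-1) * v (r, s)) - (integral {a..l} (\<lambda>y. p (y, s)) + 1 * v (l, s))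
         + (v (r, s) + (-1) * w (r, s)) + (v (l, s) + 1 * w (l, s)))) (at s)"
      by (intro DERIV_add DERIV_diff A_slanted u_slanted s' lr)
    moreover have args: "r + (-1) * (\<sigma> - s) = x + t - \<sigma>" "l + 1 * (\<sigma> - s) = x - t + \<sigma>" for \<sigma>
      by (simp_all add: r_def l_def)
    have "Z = (\<lambda>\<sigma>. A (r + (-1) * (\<sigma> - s), \<sigma>) - A (l + 1 * (\<sigma> - s), \<sigma>) +
        u (r + (-1) * (\<sigma> - s), \<sigma>) + u (l + 1 * (\<sigma> - s), \<sigma>))"
      by (rule ext) (simp only: Z_def args)
    moreover have "(integral {a..r} (\<lambda>y. p (y, s)) + (-1) * v (r, s)) - (integral {a..l} (\<lambda>y. p (y, s)) + 1 * v (l, s))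
        + (v (r, s) + (-1) * w (r, s)) + (v (l, s) + 1 * w (l, s)) = integral {l..r} (\<lambda>y. f (y, s))"
      unfolding f split[symmetric] by simp
    ultimately have "(Z has_real_derivative integral {l..r} (\<lambda>y. f (y, s))) (at s)"
      by (simp only:)
    then show ?thesis by (simp add: has_real_derivative_iff_has_vector_derivative l_def r_def)
  qed
  have Z_cont: "continuous_on {0..t} Z"
    unfolding Z_def A_def case_prod_conv
  proof (intro continuous_intros)
    show "continuous_on {0..t} (\<lambda>s. integral {a..x + t - s} (\<lambda>y. v (y, s)))"
      "continuous_on {0..t} (\<lambda>s. integral {a..x - t + s} (\<lambda>y. v (y, s)))"
      by (rule continuous_on_integral_moving_endpoint[OF v, where b = "x + t"];
          auto simp: a_def intro!: continuous_intros)+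
    show "continuous_on {0..t} (\<lambda>s. u (x + t - s, s))" "continuous_on {0..t} (\<lambda>s. u (x - t + s, s))"
      by (rule continuous_on_compose2[OF u]; auto intro!: continuous_intros)+
  qed
  have "((\<lambda>s. integral {x - t + s..x + t - s} (\<lambda>y. f (y, s))) has_integral (Z t - Z 0)) {0..t}"
    by (rule fundamental_theorem_of_calculus_countable[OF B t Z_cont Z_deriv])
  moreover have "A (x - t, 0) + integral {x - t..x + t} (\<lambda>y. v (y, 0)) = A (x + t, 0)"
    unfolding A_def case_prod_conv using t intv
    by (intro Henstock_Kurzweil_Integration.integral_combine) (auto simp: a_def)
  then have "Z t - Z 0 = 2 * u (x, t) - (u (x + t, 0) + u (x - t, 0)) - integral {x - t..x + t} (\<lambda>y. v (y, 0))"
    by (simp add: Z_def)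
  ultimately show ?thesis by (simp only:)
qed

section \<open>Identification of the data of the problem with specular derivatives of
  \<open>u\<close>\<close>

theorem theorem4p8:
  fixes \<phi> \<psi> :: "real \<Rightarrow> real"
    and f u u_x u_t :: "real \<times> real \<Rightarrow> real"
    and x t :: real
  assumes "\<phi> \<in> S_line 2" and "\<psi> \<in> S_line 1" and "f \<in> S_half_plane 0"
    and "u \<in> S_half_plane 2"
    and "\<And>x t. t \<ge> 0 \<Longrightarrow> has_partial_derivative half_plane u e_t (x, t) (u_t (x, t))"
    and "\<And>x t. t > 0 \<Longrightarrow> has_partial_derivative half_plane u e_x (x, t) (u_x (x, t))"
    and "\<And>x t. t > 0 \<Longrightarrow>
           \<exists>p q. has_specular_derivative half_plane u_t e_t (x, t) p \<and>
                 has_specular_derivative half_plane u_x e_x (x, t) q \<and>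
                 p - q = f (x, t)"
    and "\<And>x. u (x, 0) = \<phi> x"
    and "\<And>x. u_t (x, 0) = \<psi> x"
    and "t \<ge> 0"
  shows "\<psi> integrable_on {x - t..x + t} \<and>
    (\<forall>s\<in>{0..t}. (\<lambda>y. f (y, s)) integrable_on {x - t + s..x + t - s}) \<and>
    (\<lambda>s. integral {x - t + s..x + t - s} (\<lambda>y. f (y, s))) integrable_on {0..t} \<and>
    u (x, t) = 1/2 * (\<phi> (x + t) + \<phi> (x - t))
      + 1/2 * integral {x - t..x + t} \<psi>
      + 1/2 * integral {0..t} (\<lambda>s. integral {x - t + s..x + t - s} (\<lambda>y. f (y, s)))"
proof -
  define P where "P = specular_deriv half_plane e_t u"
  define Q where "Q = specular_deriv half_plane e_x u"
  define p where "p = specular_deriv half_plane e_t P"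
  define q where "q = specular_deriv half_plane e_x Q"
  \<comment> \<open>Continuity of this mixed derivative is the second clause of
    \<open>S_space\<close>; it is what rules out jumps across a segment.\<close>
  define m where "m = specular_deriv half_plane e_x P"
  have bases: "e_x \<noteq> e_t" "e \<in> Basis \<longleftrightarrow> e = e_x \<or> e = e_t" for e
    using set_basis_half_plane(2) by auto
  have ucont: "continuous_on half_plane u" using assms(4) unfolding S_space_def by simp
  have multi: "specular_derivs_exist half_plane (multi_index_dirs [e_x, e_t] \<alpha>) u \<and>
        specular_derivs half_plane (multi_index_dirs [e_x, e_t] \<alpha>) u \<in> proper_functions half_plane"
      if "\<alpha> e_x + \<alpha> e_t \<le> 2" for \<alpha>
    using assms(4) that unfolding S_space_def by auto
  have mixed: "specular_derivs_exist half_plane [e', e] u \<and>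
      continuous_on half_plane (specular_derivs half_plane [e', e] u)"
    if "e \<in> {e_x, e_t}" "e' \<in> {e_x, e_t}" "e \<noteq> e'" for e e'
  proof -
    have "multi_index_dirs [e_x, e_t] (\<lambda>_. 0) = []" by (simp add: multi_index_dirs_def)
    then show ?thesis
      using assms(4) that unfolding S_space_def by (auto dest!: spec[of _ "\<lambda>_. 0"])
  qed
  \<comment> \<open>The head of the list is the outermost operator, so the derivatives in
    \<open>e_t\<close> are taken before those in \<open>e_x\<close>.\<close>
  have dirs: "multi_index_dirs [e_x, e_t] (\<lambda>e. if e = e_x then i else j) = replicate i e_x @ replicate j e_t" for i j
    by (simp add: multi_index_dirs_def)
  have multi': "specular_derivs_exist half_plane (replicate i e_x @ replicate j e_t) u"
      "specular_derivs half_plane (replicate i e_x @ replicate j e_t) u \<in> proper_functions half_plane"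
    if "i + j \<le> 2" for i j
    using multi[of "\<lambda>e. if e = e_x then i else j"] that unfolding dirs by auto
  have P_proper: "P \<in> proper_functions half_plane" and Q_proper: "Q \<in> proper_functions half_plane"
    and p_proper: "p \<in> proper_functions half_plane"
    using multi'(2)[of 0 1] multi'(2)[of 1 0] multi'(2)[of 0 2]
    by (simp_all add: P_def Q_def p_def numeral_2_eq_2)
  have P_diff: "\<exists>d. has_specular_derivative half_plane P e a d" if "a \<in> half_plane" "e \<in> Basis" for a e
    using multi'(1)[of 0 2] mixed[of e_t e_x] that bases
    by (cases a) (auto simp: P_def numeral_2_eq_2)
  have Q_diff: "\<exists>d. has_specular_derivative half_plane Q e a d" if "a \<in> half_plane" "e \<in> Basis" for a e
    using multi'(1)[of 2 0] mixed[of e_x e_t] that bases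
    by (cases a) (auto simp: Q_def numeral_2_eq_2)
  have m_cont: "continuous_on half_plane m" using mixed[of e_t e_x] bases by (simp add: m_def P_def)
  have P_cont: "continuous_on half_plane P" and Q_cont: "continuous_on half_plane Q"
    using proper_specular_differentiable_imp_continuous[OF P_proper _ P_diff]
      proper_specular_differentiable_imp_continuous[OF Q_proper _ Q_diff] half_plane_sides_nontrivial
    by blast+
  have deriv_eq: "specular_deriv half_plane e g a = d"
    if "has_specular_derivative half_plane g e a d" "a \<in> half_plane" "e \<in> Basis" for e g a d
    using specular_deriv_eq half_plane_sides_nontrivial that by blast
  have ex_spec: "has_specular_derivative half_plane g e a (specular_deriv half_plane e g a)"
    if "\<exists>d. has_specular_derivative half_plane g e a d" "a \<in> half_plane" "e \<in> Basis" for e g a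
    using that deriv_eq by blast
  have P_eq: "P (y, s) = u_t (y, s)" if "0 \<le> s" for y s
    unfolding P_def
    using that bases by (intro deriv_eq has_partial_derivative_imp_specular assms(5)) auto
  \<comment> \<open>The classical \<open>u_x\<close> is given at positive times only, whereas
    \<open>Q\<close> is continuous up to level 0.\<close>
  have Q_eq: "Q (y, s) = u_x (y, s)" if "0 < s" for y s
    unfolding Q_def
    using that bases by (intro deriv_eq has_partial_derivative_imp_specular assms(6)) auto
  have f_eq: "p (y, s) - q (y, s) = f (y, s)" if s: "0 < s" for y s
  proof -
    obtain p' q' where pq: "has_specular_derivative half_plane u_t e_t (y, s) p'"
      "has_specular_derivative half_plane u_x e_x (y, s) q'" "p' - q' = f (y, s)"
      using assms(7)[OF s] by blast
    have "has_specular_derivative half_plane P e_t (y, s) p'"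
      using has_specular_derivative_cong[OF _ pq(1), of P] P_eq by auto
    then have "p (y, s) = p'" unfolding p_def using s bases by (intro deriv_eq) auto
    \<comment> \<open>\<open>Q\<close> and \<open>u_x\<close> may differ at level 0, so congruence
      on the whole half-plane does not apply; but quotients in direction \<open>e_x\<close> use the
      row at level \<open>s\<close> alone.\<close>
    moreover have "has_specular_derivative half_plane Q e_x (y, s) q'"
      using pq(2) unfolding has_specular_derivative_def has_right_limit_def has_left_limit_def
      by (simp add: Q_eq[OF s])
    then have "q (y, s) = q'" unfolding q_def using s bases by (intro deriv_eq) auto
    ultimately show ?thesis using pq(3) by simp
  qed
  obtain \<G> where \<G>: "finite \<G>" "\<And>G. G \<in> \<G> \<Longrightarrow> singular_hyperplane_graph half_plane p G"
    "continuous_on (half_plane - \<Union>\<G>) p"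
    using p_proper unfolding proper_functions_def piecewise_continuous_on_def by blast
  have dt: "has_specular_derivative half_plane P e_t (y, s) (p (y, s))" if "0 < s" for y s
    unfolding p_def using that bases by (intro ex_spec P_diff) auto
  have dx: "has_specular_derivative half_plane Q e_x (y, s) (q (y, s))" if "0 < s" for y s
    unfolding q_def using that bases by (intro ex_spec Q_diff) auto
  have "has_specular_derivative half_plane P e_x (y, s) (m (y, s))" if "0 < s" for y s
    unfolding m_def using that bases by (intro ex_spec P_diff) auto
  then have "countable (snd ` G)" if "G \<in> \<G>" for G
    using countable_singular_levels[OF P_cont m_cont _ dt \<G> that] by blast
  then have B: "countable (snd ` \<Union>\<G>)" using \<G>(1) by (simp add: image_Union countable_finite)
  have ut: "((\<lambda>\<sigma>. u (y, \<sigma>)) has_real_derivative P (y, s)) (at s)" if s: "0 < s" for y s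
  proof -
    have "{h. (y, s) + h *\<^sub>R e_t \<in> half_plane} = {- s..}" by auto
    moreover have "0 \<in> interior {- s..}" by (rule interiorI[of "{- s<..}"]) (use s in auto)
    ultimately have "at 0 within {h. (y, s) + h *\<^sub>R e_t \<in> half_plane} = at 0"
      by (simp only: at_within_interior)
    then have "((\<lambda>h. u ((y, s) + h *\<^sub>R e_t)) has_real_derivative P (y, s)) (at 0)"
      using assms(5)[of s y] s P_eq[of s y] by (simp only: has_partial_derivative_def less_imp_le)
    then have "((\<lambda>h. u (y, h + s)) has_real_derivative P (y, s)) (at 0)"
      by (simp add: add.commute)
    then show ?thesis using DERIV_shift[of "\<lambda>\<sigma>. u (y, \<sigma>)" "P (y, s)" 0 s] by simp
  qed
  have ux: "((\<lambda>\<eta>. u (\<eta>, s)) has_real_derivative Q (y, s)) (at y)" if s: "0 < s" for y s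
  proof -
    have "((\<lambda>h. u (h + y, s)) has_real_derivative Q (y, s)) (at 0)"
      using assms(6)[of s y] s Q_eq[of s y] by (simp add: has_partial_derivative_def add.commute)
    then show ?thesis using DERIV_shift[of "\<lambda>\<eta>. u (\<eta>, s)" "Q (y, s)" 0 y] by simp
  qed
  have main: "((\<lambda>s. integral {x - t + s..x + t - s} (\<lambda>y. f (y, s))) has_integral
    (2 * u (x, t) - (u (x + t, 0) + u (x - t, 0)) - integral {x - t..x + t} (\<lambda>y. P (y, 0)))) {0..t}"
    by (rule wave_equation_characteristic_triangle[OF ucont P_cont Q_cont ut ux dt dx \<G>(3) B f_eq assms(10)])
  have "\<psi> integrable_on {x - t..x + t}"
    using assms(2) by (auto simp: S_space_def intro: integrable_continuous_interval continuous_on_subset)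
  moreover have "(\<lambda>y. f (y, s)) integrable_on {x - t + s..x + t - s}" if "s \<in> {0..t}" for s
  proof (rule integrable_on_regulated)
    fix y :: real
    have "(y, s) \<in> half_plane" using that by simp
    moreover have "f \<in> proper_functions half_plane" using assms(3) by (simp add: S_space_def)
    moreover have "e_x \<in> Basis" using bases(2) by blast
    ultimately obtain l r where "has_left_limit half_plane f e_x (y, s) l" "has_right_limit half_plane f e_x (y, s) r"
      unfolding proper_functions_def by blast
    then show "\<exists>l r. ((\<lambda>y. f (y, s)) \<longlongrightarrow> l) (at_left y) \<and> ((\<lambda>y. f (y, s)) \<longlongrightarrow> r) (at_right y)"
      using half_plane_sides[OF \<open>(y, s) \<in> half_plane\<close>]
      by (auto simp: has_left_limit_def has_right_limit_def filterlim_shift_left[of _ _ y] filterlim_shift_right[of _ _ y])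
  qed
  \<comment> \<open>At level 0 both \<open>u_t\<close> and \<open>P\<close> are one-sided
    derivatives in time, so they agree there too and the initial velocity is attained.\<close>
  moreover have "(\<lambda>y. P (y, 0)) = \<psi>" using P_eq assms(9) by auto
  note main' = main[unfolded this assms(8)]
  have "u (x, t) = 1/2 * (\<phi> (x + t) + \<phi> (x - t)) + 1/2 * integral {x - t..x + t} \<psi>
      + 1/2 * integral {0..t} (\<lambda>s. integral {x - t + s..x + t - s} (\<lambda>y. f (y, s)))"
    unfolding integral_unique[OF main'] by (simp add: field_simps)
  ultimately show ?thesis using has_integral_integrable[OF main'] by blast
qed

end
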